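(* Let $n\in\mathbb{N}$, $p\in(0,1)$, and let $U_N=\bigcup_{k=1}^N G_k$ be the union of $N$ independent random graphs $G_k\in\mathcal{G}(n,p)$ on the common node set $[n]$. Let $\lambda_{min}=2\left(1-\cos\frac{\pi}{n}\right)$, let $q=1-p$, and let \[ N_{min}:=\frac{1}{\log q}\log\left(\frac{4n^2+4n\cos\frac{\pi}{n}-\tau(n)-8n}{6n^2-8n}\right),\quad \tau(n):=\bigg(16n^2(n-2)\Big(1-\cos\frac{\pi}{n}\Big)+32n(2-n)\Big(1-\cos\frac{\pi}{n}\Big)^2+4n^2(n-2)^2\bigg)^{1/2}. \] Set $\hat p=1-(1-p)^N$ and $\hat q=1-\hat p$. If $N\ge N_{min}$, then \[ \mathbb{P}\big[\lambda_2(U_N)\ge\lambda_{min}\big]\ge\left(1-\frac{2\left(1-\cos\frac{\pi}{n}\right)}{n\hat p}\right)^2\left(\frac{\left(n\hat p-\sqrt{2n(n-2)\hat p\hat q}\right)^2}{n(n-2)\hat p^2+2n\hat p}\right). \]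
   Context: $\mathcal{G}(n,p)$ denotes the Erdős–Rényi model: a simple undirected graph on nodes $[n]$ in which each of the $\binom{n}{2}$ possible edges is present independently with probability $p$. The union of graphs on the same node set has as edge set the union of their edge sets. For a graph with Laplacian $L=D-A$ (degree matrix minus adjacency matrix) and eigenvalues $0=\lambda_1\le\lambda_2\le\dots\le\lambda_n$, the algebraic connectivity is $\lambda_2$; $\lambda_{min}=2(1-\cos\frac{\pi}{n})$ is the minimum algebraic connectivity among connected graphs on $n$ nodes (attained by the path graph). *)

theory Defs
  imports "HOL-Probability.Probability" "Jordan_Normal_Form.Char_Poly"
begin

definition all_edges :: "nat \<Rightarrow> nat set set" where
  "all_edges n = {e. \<exists>i j. i < n \<and> j < n \<and> i \<noteq> j \<and> e = {i, j}}"

definition gnp :: "nat \<Rightarrow> real \<Rightarrow> nat set set pmf" where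
  "gnp n p = map_pmf (\<lambda>f. {e \<in> all_edges n. f e})
                     (Pi_pmf (all_edges n) False (\<lambda>_. bernoulli_pmf p))"

definition union_gnp :: "nat \<Rightarrow> real \<Rightarrow> nat \<Rightarrow> nat set set pmf" where
  "union_gnp n p N = map_pmf (\<lambda>G. \<Union>k<N. G k)
                        (Pi_pmf {..<N} {} (\<lambda>_. gnp n p))"

definition laplacian :: "nat \<Rightarrow> nat set set \<Rightarrow> real mat" where
  "laplacian n E = mat n n (\<lambda>(i, j).
      if i = j then real (card {e \<in> E. i \<in> e})
      else if {i, j} \<in> E then -1 else 0)"

text \<open>Eigenvalues (with multiplicity) in ascending order: the roots of the
  characteristic polynomial (all real for the symmetric Laplacian).\<close>
definition eigenvalues_sorted :: "real mat \<Rightarrow> real list" where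
  "eigenvalues_sorted A = sorted_list_of_multiset (proots (char_poly A))"

definition alg_conn :: "nat \<Rightarrow> nat set set \<Rightarrow> real" where
  "alg_conn n E = eigenvalues_sorted (laplacian n E) ! 1"

definition lambda_min :: "nat \<Rightarrow> real" where
  "lambda_min n = 2 * (1 - cos (pi / real n))"

definition tau :: "nat \<Rightarrow> real" where
  "tau n = sqrt (16 * (real n)^2 * (real n - 2) * (1 - cos (pi / real n))
               + 32 * real n * (2 - real n) * (1 - cos (pi / real n))^2
               + 4 * (real n)^2 * (real n - 2)^2)"

definition N_min :: "nat \<Rightarrow> real \<Rightarrow> real" where
  "N_min n p = (1 / ln (1 - p)) *
     ln ((4 * (real n)^2 + 4 * real n * cos (pi / real n) - tau n - 8 * real n)
         / (6 * (real n)^2 - 8 * real n))"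

end

theory Submission
  imports Defs "Jordan_Normal_Form.Schur_Decomposition"
begin

text \<open>
  Connectivity is never used. The probability is bounded by second moments of the edge set alone,
  since the sum and the sum of squares of the eigenvalues other than the trivial \<open>0\<close> are traces.
  Write \<open>Q = (1 - p)\<^sup>N\<close>, \<open>P = 1 - Q\<close>, and let \<open>T\<close> and \<open>V\<close> be the mean and variance of these
  \<open>n - 1\<close> eigenvalues. The smallest of them satisfies
  \<open>(T - \<lambda>)\<^sup>2 \<le> (n - 2) V\<close>, and taking expectations gives \<open>E \<lambda> \<ge> n P - c\<close> with
  \<open>c = sqrt (2 n (n - 2) P Q) sqrt ((n - 2) / (n - 1))\<close>. The Paley--Zygmund inequality then yields the
  lower bound \<open>(n P - c - \<lambda>\<^sub>m\<^sub>i\<^sub>n)\<^sup>2 / S\<close>, where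
  \<open>S = n (n - 2) P\<^sup>2 + 2 n P\<close> is the mean of the squared eigenvalues. The extra factor
  \<open>sqrt ((n - 2) / (n - 1))\<close> in \<open>c\<close> is what makes this at least the claimed bound for \<open>n \<ge> 5\<close>.

  It does not suffice for \<open>n = 3\<close> and \<open>n = 4\<close>. There \<open>\<lambda> \<ge> \<lambda>\<^sub>m\<^sub>i\<^sub>n\<close> holds as soon as at most
  \<open>n - 2\<close> edges are missing, and this event is bounded below by the second factorial moment of the
  number of missing edges.
\<close>

section \<open>Spectra of real symmetric matrices\<close>

text \<open>By symmetry the Hermitian form \<open>s\<close> is its own conjugate, and on an
  eigenvector it equals \<open>e\<close> times the positive number \<open>w\<close>.\<close>

lemma symmetric_mat_complex_eigenvalue_real:
  fixes A :: "real mat"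
  assumes A: "A \<in> carrier_mat n n"
    and sym: "\<And>i j. i < n \<Longrightarrow> j < n \<Longrightarrow> A $$ (i, j) = A $$ (j, i)"
    and ev: "eigenvalue (map_mat complex_of_real A) e"
  shows "e \<in> \<real>"
proof -
  obtain v where "eigenvector (map_mat complex_of_real A) v e"
    using ev unfolding eigenvalue_def by blast
  then have v: "v \<in> carrier_vec n" "v \<noteq> 0\<^sub>v n"
    and Av: "map_mat complex_of_real A *\<^sub>v v = e \<cdot>\<^sub>v v"
    using A unfolding eigenvector_def by auto
  have row: "(\<Sum>j<n. complex_of_real (A $$ (i, j)) * v $ j) = e * v $ i" if "i < n" for i
  proof -
    have "(map_mat complex_of_real A *\<^sub>v v) $ i = (\<Sum>j<n. complex_of_real (A $$ (i, j)) * v $ j)"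
      using A v that by (auto simp: scalar_prod_def lessThan_atLeast0 intro!: sum.cong)
    then show ?thesis using Av that v by simp
  qed
  define s where "s = (\<Sum>i<n. \<Sum>j<n. cnj (v $ i) * (complex_of_real (A $$ (i, j)) * v $ j))"
  define w where "w = (\<Sum>i<n. (cmod (v $ i))\<^sup>2)"
  have "s = e * of_real w"
  proof -
    have "s = (\<Sum>i<n. cnj (v $ i) * (e * v $ i))"
      unfolding s_def sum_distrib_left[symmetric] by (simp add: row)
    also have "\<dots> = e * of_real w"
      unfolding w_def of_real_sum sum_distrib_left
      by (intro sum.cong) (simp_all only: complex_norm_square mult_ac)
    finally show ?thesis .
  qed
  moreover have "cnj s = s"
  proof -
    have "cnj s = (\<Sum>i<n. \<Sum>j<n. cnj (v $ j) * (complex_of_real (A $$ (j, i)) * v $ i))"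
      unfolding s_def by (auto simp: sym mult_ac intro!: sum.cong)
    also have "\<dots> = s" unfolding s_def by (rule sum.swap)
    finally show ?thesis .
  qed
  ultimately have "cnj e * of_real w = e * of_real w" by (metis complex_cnj_complex_of_real complex_cnj_mult)
  moreover have "w > 0"
  proof -
    obtain i where i: "i < n" "v $ i \<noteq> 0" using v by (metis carrier_vecD eq_vecI index_zero_vec)
    show ?thesis unfolding w_def by (rule sum_pos2[where i = i]) (use i in auto)
  qed
  ultimately have "cnj e = e" by simp
  then show ?thesis by (simp add: Reals_cnj_iff)
qed

text \<open>Over the complex numbers the polynomial splits. Its roots are eigenvalues, hence real,
  so the factorization pulls back along the injective
  \<open>map_poly complex_of_real\<close>.\<close>

lemma symmetric_mat_char_poly_splits:
  fixes A :: "real mat"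
  assumes A: "A \<in> carrier_mat n n"
    and sym: "\<And>i j. i < n \<Longrightarrow> j < n \<Longrightarrow> A $$ (i, j) = A $$ (j, i)"
  obtains rs where "char_poly A = (\<Prod>r\<leftarrow>rs. [:- r, 1:])" "length rs = n"
proof -
  let ?B = "map_mat complex_of_real A"
  have B: "?B \<in> carrier_mat n n" using A by simp
  obtain as where as: "char_poly ?B = (\<Prod>a\<leftarrow>as. [:- a, 1:])" "length as = n"
    using char_poly_factorized[OF B] by blast
  have real: "a \<in> \<real>" if "a \<in> set as" for a
  proof (rule symmetric_mat_complex_eigenvalue_real[OF A sym])
    show "eigenvalue ?B a"
      unfolding eigenvalue_root_char_poly[OF B] as(1) poly_prod_list
      using that by (auto simp: prod_list_zero_iff)
  qed auto
  define rs where "rs = map Re as"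
  have asrs: "as = map complex_of_real rs"
    unfolding rs_def using real by (induction as) auto
  have cp: "char_poly ?B = map_poly complex_of_real (char_poly A)"
    by (rule of_real_hom.char_poly_hom[OF A])
  interpret hom: map_poly_inj_idom_hom complex_of_real ..
  have "map_poly complex_of_real (\<Prod>r\<leftarrow>rs. [:- r, 1:]) = (\<Prod>a\<leftarrow>map complex_of_real rs. [:- a, 1:])" for rs
    by (induction rs) (simp_all add: hom.hom_mult del: mult_pCons_left)
  then have "map_poly complex_of_real (char_poly A) = map_poly complex_of_real (\<Prod>r\<leftarrow>rs. [:- r, 1:])"
    using cp as asrs by simp
  then have "char_poly A = (\<Prod>r\<leftarrow>rs. [:- r, 1:])"
    by simp
  with as(2) show thesis by (intro that[of rs]) (auto simp: rs_def)
qed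

lemma eigenvalues_sorted_of_split:
  assumes "char_poly A = (\<Prod>r\<leftarrow>rs. [:- r, 1:])"
  shows "eigenvalues_sorted A = sort rs"
proof -
  have "proots (\<Prod>r\<leftarrow>rs. [:- r, 1:]) = mset rs"
  proof (induction rs)
    case (Cons a rs)
    have "(\<Prod>r\<leftarrow>rs. [:- r, 1:]) \<noteq> 0" by (auto simp: prod_list_zero_iff)
    then have "proots ([:- a, 1:] * (\<Prod>r\<leftarrow>rs. [:- r, 1:])) = proots [:- a, 1:] + proots (\<Prod>r\<leftarrow>rs. [:- r, 1:])"
      by (intro proots_mult) auto
    then show ?case using Cons by (simp del: mult_pCons_left)
  qed simp
  then show ?thesis by (simp add: eigenvalues_sorted_def assms)
qed

section \<open>Traces as power sums of the eigenvalues\<close>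

definition mat_trace :: "'a::comm_ring_1 mat \<Rightarrow> 'a" where
  "mat_trace A = (\<Sum>i<dim_row A. A $$ (i, i))"

lemma mat_trace_mult_comm:
  assumes "A \<in> carrier_mat n m" "B \<in> carrier_mat m n"
  shows "mat_trace (A * B) = mat_trace (B * A)"
proof -
  have "mat_trace (A * B) = (\<Sum>i<n. \<Sum>j<m. A $$ (i, j) * B $$ (j, i))"
    using assms by (auto simp: mat_trace_def scalar_prod_def lessThan_atLeast0 intro!: sum.cong)
  also have "\<dots> = (\<Sum>j<m. \<Sum>i<n. B $$ (j, i) * A $$ (i, j))"
    by (subst sum.swap) (simp add: mult.commute)
  also have "\<dots> = mat_trace (B * A)"
    using assms by (auto simp: mat_trace_def scalar_prod_def lessThan_atLeast0 intro!: sum.cong)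
  finally show ?thesis .
qed

text \<open>The trace is cyclic, and the pair \<open>P\<close>, \<open>Q\<close> that conjugates
  \<open>A\<close> to \<open>B\<close> also conjugates \<open>A * A\<close> to
  \<open>B * B\<close>.\<close>

lemma mat_trace_similar:
  assumes "similar_mat_wit A B P Q"
  shows "mat_trace A = mat_trace B" "mat_trace (A * A) = mat_trace (B * B)"
proof -
  have tr: "mat_trace A = mat_trace B" if "similar_mat_wit A B P Q" for A B P Q :: "'a mat"
  proof -
    obtain n where *: "n = dim_row A" by simp
    note w = similar_mat_witD[OF * that]
    have "mat_trace A = mat_trace (P * (B * Q))" using w by (simp add: assoc_mult_mat[of P n n B n Q n])
    also have "\<dots> = mat_trace ((B * Q) * P)" by (rule mat_trace_mult_comm) (use w in auto)
    also have "(B * Q) * P = B" using w by (simp add: assoc_mult_mat[of B n n Q n P n])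
    finally show ?thesis .
  qed
  show "mat_trace A = mat_trace B" by (rule tr[OF assms])
  obtain n where *: "n = dim_row A" by simp
  note w = similar_mat_witD[OF * assms]
  have c: "A \<in> carrier_mat n n" "B \<in> carrier_mat n n" "P \<in> carrier_mat n n" "Q \<in> carrier_mat n n"
    using w by auto
  have "A * A = P * B * Q * (P * B * Q)" using w by simp
  also have "\<dots> = P * B * (Q * P) * B * Q"
    using c by (simp add: assoc_mult_mat[where n\<^sub>1=n and n\<^sub>2=n and n\<^sub>3=n and n\<^sub>4=n])
  also have "\<dots> = P * (B * B) * Q" using c w
    by (simp add: assoc_mult_mat[where n\<^sub>1=n and n\<^sub>2=n and n\<^sub>3=n and n\<^sub>4=n])
  finally have "similar_mat_wit (A * A) (B * B) P Q"
    by (intro similar_mat_witI[of _ _ n]) (use w c in auto)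
  then show "mat_trace (A * A) = mat_trace (B * B)" by (rule tr)
qed

text \<open>A Schur decomposition puts \<open>rs\<close> on the diagonal of a similar upper
  triangular matrix, and squaring a triangular matrix squares its diagonal entries.\<close>

lemma mat_trace_char_poly_roots:
  fixes A :: "real mat"
  assumes A: "A \<in> carrier_mat n n" and rs: "char_poly A = (\<Prod>r\<leftarrow>rs. [:- r, 1:])"
  shows "mat_trace A = sum_list rs" "mat_trace (A * A) = (\<Sum>r\<leftarrow>rs. r\<^sup>2)"
proof -
  obtain B P Q where schur: "schur_decomposition A rs = (B, P, Q)" by (metis prod_cases3)
  note s = schur_decomposition[OF A rs schur]
  then have w: "similar_mat_wit A B P Q" and ut: "upper_triangular B" and d: "diag_mat B = rs" by auto
  have B: "B \<in> carrier_mat n n" using similar_mat_witD2[OF A w] by auto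
  have "mat_trace B = sum_list (diag_mat B)"
    by (simp add: mat_trace_def diag_mat_def sum_list_sum_nth lessThan_atLeast0)
  then show "mat_trace A = sum_list rs" using mat_trace_similar(1)[OF w] d by simp
  have "(B * B) $$ (i, i) = (B $$ (i, i))\<^sup>2" if "i < n" for i
  proof -
    have "(B * B) $$ (i, i) = (\<Sum>j<n. B $$ (i, j) * B $$ (j, i))"
      using B that by (auto simp: scalar_prod_def lessThan_atLeast0 intro!: sum.cong)
    \<comment> \<open>For \<open>j\<close> distinct from \<open>i\<close>, one of the entries
      \<open>(i, j)\<close> and \<open>(j, i)\<close> lies below the diagonal.\<close>
    also have "\<dots> = (\<Sum>j\<in>{i}. B $$ (i, j) * B $$ (j, i))"
    proof (rule sum.mono_neutral_right)
      show "\<forall>j\<in>{..<n} - {i}. B $$ (i, j) * B $$ (j, i) = 0"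
      proof
        fix j assume "j \<in> {..<n} - {i}"
        then have "j < i \<or> i < j" "j < n" by auto
        then show "B $$ (i, j) * B $$ (j, i) = 0"
          using upper_triangularD[OF ut] B that by auto
      qed
    qed (use that in auto)
    finally show ?thesis by (simp add: power2_eq_square)
  qed
  then have "mat_trace (B * B) = (\<Sum>r\<leftarrow>diag_mat B. r\<^sup>2)"
    using B by (simp add: mat_trace_def diag_mat_def sum_list_sum_nth lessThan_atLeast0)
  then show "mat_trace (A * A) = (\<Sum>r\<leftarrow>rs. r\<^sup>2)" using mat_trace_similar(2)[OF w] d by simp
qed

section \<open>Missing edges in a union of random graphs\<close>

lemma finite_all_edges: "finite (all_edges n)"
proof (rule finite_subset)
  show "all_edges n \<subseteq> Pow {..<n}" by (auto simp: all_edges_def)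
qed simp

text \<open>The event is a product set: coordinate \<open>e\<close> is forced to
  \<open>False\<close> for \<open>e\<close> in \<open>S\<close> and is free otherwise.\<close>

lemma prob_gnp_disjoint:
  assumes p: "0 \<le> p" "p \<le> 1" and S: "S \<subseteq> all_edges n"
  shows "measure_pmf.prob (gnp n p) {G. S \<inter> G = {}} = (1 - p) ^ card S"
proof -
  let ?B = "\<lambda>e. if e \<in> S then {False} else UNIV"
  have "measure_pmf.prob (gnp n p) {G. S \<inter> G = {}} =
    measure_pmf.prob (Pi_pmf (all_edges n) False (\<lambda>_. bernoulli_pmf p)) (Pi (all_edges n) ?B)"
    unfolding gnp_def measure_map_pmf
    by (rule arg_cong[where f = "measure_pmf.prob _"]) (use S in \<open>auto simp: Pi_def split: if_splits\<close>)
  also have "\<dots> = (\<Prod>e\<in>all_edges n. measure_pmf.prob (bernoulli_pmf p) (?B e))"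
    by (rule measure_Pi_pmf_Pi) (rule finite_all_edges)
  also have "\<dots> = (\<Prod>e\<in>all_edges n. if e \<in> S then 1 - p else 1)"
    by (rule prod.cong) (use p in \<open>auto simp: measure_pmf_single\<close>)
  also have "\<dots> = (\<Prod>e\<in>all_edges n \<inter> S. 1 - p)"
    by (subst prod.inter_restrict) (auto simp: finite_all_edges)
  also have "all_edges n \<inter> S = S" using S by auto
  finally show ?thesis by simp
qed

text \<open>The union avoids \<open>S\<close> exactly when each of the \<open>N\<close> independent
  graphs does. Hence edges are missing from the union independently, each with probability
  \<open>(1 - p) ^ N\<close>.\<close>

lemma prob_union_gnp_disjoint:
  assumes "0 \<le> p" "p \<le> 1" "S \<subseteq> all_edges n"
  shows "measure_pmf.prob (union_gnp n p N) {E. S \<inter> E = {}} = ((1 - p) ^ N) ^ card S"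
proof -
  have "measure_pmf.prob (union_gnp n p N) {E. S \<inter> E = {}} =
    measure_pmf.prob (Pi_pmf {..<N} {} (\<lambda>_. gnp n p)) (Pi {..<N} (\<lambda>_. {G. S \<inter> G = {}}))"
    unfolding union_gnp_def measure_map_pmf
    by (rule arg_cong[where f = "measure_pmf.prob _"]) auto
  also have "\<dots> = (\<Prod>k<N. measure_pmf.prob (gnp n p) {G. S \<inter> G = {}})"
    by (rule measure_Pi_pmf_Pi) simp
  also have "\<dots> = ((1 - p) ^ N) ^ card S"
    using assms by (simp add: prob_gnp_disjoint mult.commute flip: power_mult)
  finally show ?thesis .
qed

lemma set_pmf_union_gnp: "set_pmf (union_gnp n p N) \<subseteq> Pow (all_edges n)"
proof -
  have "set_pmf (gnp n p) \<subseteq> Pow (all_edges n)" by (auto simp: gnp_def)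
  then have "(\<Union>k<N. G k) \<subseteq> all_edges n" if "\<forall>k<N. G k \<in> set_pmf (gnp n p)" for G
    using that by blast
  then show ?thesis
    by (auto simp: union_gnp_def set_Pi_pmf PiE_dflt_def)
qed

lemma integrable_union_gnp [simp]:
  fixes f :: "nat set set \<Rightarrow> real"
  shows "integrable (measure_pmf (union_gnp n p N)) f"
  by (rule integrable_measure_pmf_finite[OF finite_subset[OF set_pmf_union_gnp]])
     (simp add: finite_all_edges)

text \<open>The count is a sum of indicators, its square a sum over pairs of edges. Later
  \<open>A\<close> is either the set of all edges or the star of one node.\<close>

lemma expectation_missing_edges:
  assumes p: "0 \<le> p" "p \<le> 1" and A: "A \<subseteq> all_edges n"
  shows "measure_pmf.expectation (union_gnp n p N) (\<lambda>E. real (card (A - E)))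
    = real (card A) * (1 - p) ^ N" (is ?lin)
  and "measure_pmf.expectation (union_gnp n p N) (\<lambda>E. (real (card (A - E)))\<^sup>2)
    = real (card A) * (1 - p) ^ N + real (card A) * (real (card A) - 1) * ((1 - p) ^ N)\<^sup>2" (is ?sq)
proof -
  let ?U = "union_gnp n p N" and ?Q = "(1 - p) ^ N"
  have fin: "finite A" using A finite_all_edges finite_subset by blast
  have card: "real (card (A - E)) = (\<Sum>e\<in>A. indicator {E. {e} \<inter> E = {}} E)" for E
  proof -
    have "real (card (A - E)) = (\<Sum>e\<in>A - E. 1)" by simp
    also have "\<dots> = (\<Sum>e\<in>A. indicator {E. {e} \<inter> E = {}} E)"
      by (rule sum.mono_neutral_cong_left) (auto simp: fin indicator_def)
    finally show ?thesis .
  qed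
  have "measure_pmf.expectation ?U (\<lambda>E. real (card (A - E))) =
    (\<Sum>e\<in>A. measure_pmf.prob ?U {E. {e} \<inter> E = {}})"
    unfolding card by (simp add: Bochner_Integration.integral_sum)
  also have "\<dots> = (\<Sum>e\<in>A. ?Q)"
  proof (rule sum.cong[OF refl])
    fix e assume "e \<in> A"
    then have "measure_pmf.prob ?U {E. {e} \<inter> E = {}} = ?Q ^ card {e}"
      using p A by (intro prob_union_gnp_disjoint) auto
    then show "measure_pmf.prob ?U {E. {e} \<inter> E = {}} = ?Q" by simp
  qed
  finally show ?lin by simp
  have sq: "(real (card (A - E)))\<^sup>2 = (\<Sum>e\<in>A. \<Sum>f\<in>A. indicator {E. {e, f} \<inter> E = {}} E)" for E
    unfolding card power2_eq_square sum_product
    by (intro sum.cong refl) (auto simp: indicator_def)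
  have "measure_pmf.expectation ?U (\<lambda>E. (real (card (A - E)))\<^sup>2) =
    (\<Sum>e\<in>A. \<Sum>f\<in>A. measure_pmf.prob ?U {E. {e, f} \<inter> E = {}})"
    unfolding sq by (simp add: Bochner_Integration.integral_sum)
  \<comment> \<open>A pair with \<open>e = f\<close> is a single edge and has probability
    \<open>?Q\<close> in place of \<open>?Q\<^sup>2\<close>.\<close>
  also have "\<dots> = (\<Sum>e\<in>A. \<Sum>f\<in>A. ?Q\<^sup>2 + (if e = f then ?Q - ?Q\<^sup>2 else 0))"
  proof (intro sum.cong refl)
    fix e f assume "e \<in> A" "f \<in> A"
    then have "measure_pmf.prob ?U {E. {e, f} \<inter> E = {}} = ?Q ^ card {e, f}"
      using p A by (intro prob_union_gnp_disjoint) auto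
    then show "measure_pmf.prob ?U {E. {e, f} \<inter> E = {}} = ?Q\<^sup>2 + (if e = f then ?Q - ?Q\<^sup>2 else 0)"
      by (auto simp: card_insert_if power2_eq_square)
  qed
  also have "\<dots> = (\<Sum>e\<in>A. real (card A) * ?Q\<^sup>2 + (?Q - ?Q\<^sup>2))"
    using fin by (intro sum.cong refl) (simp add: sum.distrib)
  also have "\<dots> = real (card A) * ?Q + real (card A) * (real (card A) - 1) * ?Q\<^sup>2"
    by (simp add: algebra_simps power2_eq_square)
  finally show ?sq .
qed

section \<open>Counting degrees\<close>

lemma card_incident_edges:
  assumes "i < n"
  shows "card {e \<in> all_edges n. i \<in> e} = n - 1"
proof -
  have "{e \<in> all_edges n. i \<in> e} = (\<lambda>j. {i, j}) ` ({..<n} - {i})"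
    using assms by (auto simp: all_edges_def)
  moreover have "inj_on (\<lambda>j. {i, j}) ({..<n} - {i})"
    by (auto simp: inj_on_def doubleton_eq_iff)
  ultimately show ?thesis using assms by (simp add: card_image)
qed

lemma handshake:
  assumes "E \<subseteq> all_edges n"
  shows "(\<Sum>i<n. card {e \<in> E. i \<in> e}) = 2 * card E"
proof -
  have fin: "finite E" using assms finite_all_edges finite_subset by blast
  have c2: "card e = 2 \<and> e \<subseteq> {..<n}" if "e \<in> E" for e
    using that assms by (auto simp: all_edges_def)
  have "(\<Sum>i<n. card {e \<in> E. i \<in> e}) = (\<Sum>i<n. \<Sum>e\<in>E. if i \<in> e then 1 else 0)"
    using fin by (simp add: sum.If_cases Int_def)
  also have "\<dots> = (\<Sum>e\<in>E. \<Sum>i<n. if i \<in> e then 1 else 0)" by (rule sum.swap)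
  also have "\<dots> = (\<Sum>e\<in>E. 2)"
  proof (rule sum.cong[OF refl])
    fix e assume "e \<in> E"
    then have "{..<n} \<inter> e = e" "card e = 2" using c2 by blast+
    then show "(\<Sum>i<n. if i \<in> e then 1 else 0) = (2::nat)" 
      by (simp add: sum.If_cases)
  qed
  finally show ?thesis by simp
qed

lemma card_all_edges: "2 * card (all_edges n) = n * (n - 1)"
  using handshake[of "all_edges n" n] by (simp add: card_incident_edges)

text \<open>The left side counts triples \<open>(i, e, f)\<close> with \<open>i\<close> in both
  edges, and two distinct edges share at most one node. It serves the cases \<open>n = 3\<close> and
  \<open>n = 4\<close>, where few edges are missing.\<close>

lemma sum_degree_squares_le:
  assumes "E \<subseteq> all_edges n"
  shows "(\<Sum>i<n. (card {e \<in> E. i \<in> e})\<^sup>2) \<le> (card E)\<^sup>2 + card E"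
proof -
  have fin: "finite E" using assms finite_all_edges finite_subset by blast
  have c2: "card e = 2 \<and> e \<subseteq> {..<n}" if "e \<in> E" for e
    using that assms by (auto simp: all_edges_def)
  have "(\<Sum>i<n. (card {e \<in> E. i \<in> e})\<^sup>2) = (\<Sum>i<n. \<Sum>e\<in>E. \<Sum>f\<in>E. if i \<in> e \<inter> f then 1 else 0)"
  proof (rule sum.cong[OF refl])
    fix i
    have "card {e \<in> E. i \<in> e} = (\<Sum>e\<in>E. if i \<in> e then 1 else 0)"
      using fin by (simp add: sum.If_cases Int_def)
    then show "(card {e \<in> E. i \<in> e})\<^sup>2 = (\<Sum>e\<in>E. \<Sum>f\<in>E. if i \<in> e \<inter> f then 1 else 0)"
      by (auto simp: power2_eq_square sum_product intro!: sum.cong)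
  qed
  also have "\<dots> = (\<Sum>e\<in>E. \<Sum>f\<in>E. \<Sum>i<n. if i \<in> e \<inter> f then 1 else 0)"
    by (subst sum.swap, intro sum.cong refl, rule sum.swap)
  also have "\<dots> \<le> (\<Sum>e\<in>E. \<Sum>f\<in>E. 1 + (if e = f then 1 else 0))"
  proof (intro sum_mono)
    fix e f assume ef: "e \<in> E" "f \<in> E"
    have "(\<Sum>i<n. if i \<in> e \<inter> f then 1 else 0) = card ({..<n} \<inter> (e \<inter> f))"
      by (simp only: sum.If_cases finite_lessThan sum.neutral_const add_0_right card_eq_sum Collect_mem_eq)
    also have "{..<n} \<inter> (e \<inter> f) = e \<inter> f" using ef c2 by blast
    also have "card (e \<inter> f) \<le> 1 + (if e = f then 1 else 0)"
    proof (cases "e = f")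
      case False
      have fins: "finite e" "finite f" using c2 ef by (metis card.infinite zero_neq_numeral)+
      have "e \<inter> f \<noteq> e" using False c2[OF ef(1)] c2[OF ef(2)] fins
        by (metis card_subset_eq inf.absorb_iff1)
      then have "card (e \<inter> f) < card e" using fins by (intro psubset_card_mono) auto
      then show ?thesis using c2[OF ef(1)] by simp
    qed (use c2[OF ef(1)] in auto)
    finally show "(\<Sum>i<n. if i \<in> e \<inter> f then 1 else 0) \<le> 1 + (if e = f then 1 else (0::nat))" .
  qed
  also have "\<dots> = (\<Sum>e\<in>E. card E + 1)"
    unfolding sum.distrib using fin by simp
  also have "\<dots> = (card E)\<^sup>2 + card E"
    by (simp add: power2_eq_square)
  finally show ?thesis .
qed

section \<open>The Laplacian spectrum\<close>

definition degree_in :: "nat set set \<Rightarrow> nat \<Rightarrow> nat" where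
  "degree_in E i = card {e \<in> E. i \<in> e}"

lemma degree_in_neighbours:
  assumes "E \<subseteq> all_edges n" "i < n"
  shows "degree_in E i = card {j. j < n \<and> j \<noteq> i \<and> {i, j} \<in> E}"
proof -
  have "{e \<in> E. i \<in> e} = (\<lambda>j. {i, j}) ` {j. j < n \<and> j \<noteq> i \<and> {i, j} \<in> E}"
  proof safe
    fix e assume e: "e \<in> E" "i \<in> e"
    then obtain a b where "a < n" "b < n" "a \<noteq> b" "e = {a, b}"
      using assms by (auto simp: all_edges_def)
    with e show "e \<in> (\<lambda>j. {i, j}) ` {j. j < n \<and> j \<noteq> i \<and> {i, j} \<in> E}"
      by (auto simp: insert_commute image_iff)
  qed
  moreover have "inj_on (\<lambda>j. {i, j}) {j. j < n \<and> j \<noteq> i \<and> {i, j} \<in> E}"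
    by (auto simp: inj_on_def doubleton_eq_iff)
  ultimately show ?thesis by (simp add: degree_in_def card_image)
qed

lemma laplacian_carrier: "laplacian n E \<in> carrier_mat n n"
  by (simp add: laplacian_def)

lemma laplacian_entry:
  assumes "i < n" "j < n"
  shows "laplacian n E $$ (i, j) =
    (if i = j then real (degree_in E i) else if {i, j} \<in> E then -1 else 0)"
  using assms by (simp add: laplacian_def degree_in_def)

text \<open>Zero row sums make the all-ones vector a null vector. By symmetry, the row sums of
  squares are the diagonal entries of the squared Laplacian.\<close>

lemma laplacian_row_sums:
  assumes E: "E \<subseteq> all_edges n" and i: "i < n"
  shows "(\<Sum>j<n. laplacian n E $$ (i, j)) = 0"
    and "(\<Sum>j<n. (laplacian n E $$ (i, j))\<^sup>2) = (real (degree_in E i))\<^sup>2 + real (degree_in E i)"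
proof -
  have card: "(\<Sum>j\<in>{..<n} - {i}. if {i, j} \<in> E then 1 else 0) = real (degree_in E i)"
  proof -
    have "{..<n} - {i} - {j. {i, j} \<notin> E} = {j. j < n \<and> j \<noteq> i \<and> {i, j} \<in> E}" by auto
    moreover have "(\<Sum>j\<in>{..<n} - {i}. if {i, j} \<in> E then 1 else 0)
      = (\<Sum>j\<in>{..<n} - {i} - {j. {i, j} \<notin> E}. 1::real)"
      by (intro sum.mono_neutral_cong_right) auto
    ultimately show ?thesis using degree_in_neighbours[OF E i] by simp
  qed
  have split: "(\<Sum>j<n. f j) = f i + (\<Sum>j\<in>{..<n} - {i}. f j)" for f :: "nat \<Rightarrow> real"
    using i by (simp add: sum.remove)
  have "(\<Sum>j\<in>{..<n} - {i}. laplacian n E $$ (i, j)) = (\<Sum>j\<in>{..<n} - {i}. - (if {i, j} \<in> E then 1 else 0))"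
    using i by (intro sum.cong refl) (auto simp: laplacian_entry)
  then show "(\<Sum>j<n. laplacian n E $$ (i, j)) = 0"
    unfolding split using i card by (simp add: sum_negf laplacian_entry)
  have "(\<Sum>j\<in>{..<n} - {i}. (laplacian n E $$ (i, j))\<^sup>2) = (\<Sum>j\<in>{..<n} - {i}. (if {i, j} \<in> E then 1 else 0))"
    using i by (intro sum.cong refl) (auto simp: laplacian_entry)
  then show "(\<Sum>j<n. (laplacian n E $$ (i, j))\<^sup>2) = (real (degree_in E i))\<^sup>2 + real (degree_in E i)"
    unfolding split using i card by (simp add: laplacian_entry)
qed

text \<open>Maximum principle: at a coordinate \<open>i\<close> of largest modulus, the zero row sum
  turns \<open>r * (v $ i)\<^sup>2\<close> into a sum of nonnegative terms.\<close>

lemma laplacian_eigenvalue_nonneg: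
  assumes E: "E \<subseteq> all_edges n" and ev: "eigenvalue (laplacian n E) r"
  shows "r \<ge> 0"
proof -
  let ?L = "laplacian n E"
  obtain v where "eigenvector ?L v r" using ev unfolding eigenvalue_def by blast
  then have v: "v \<in> carrier_vec n" "v \<noteq> 0\<^sub>v n" and Lv: "?L *\<^sub>v v = r \<cdot>\<^sub>v v"
    using laplacian_carrier[of n E] unfolding eigenvector_def by auto
  have n0: "n \<noteq> 0" using v by (metis carrier_vecD eq_vecI index_zero_vec(2) less_nat_zero_code)
  obtain i where i: "i < n" and mx: "\<And>j. j < n \<Longrightarrow> \<bar>v $ j\<bar> \<le> \<bar>v $ i\<bar>"
  proof -
    have "Max ((\<lambda>j. \<bar>v $ j\<bar>) ` {..<n}) \<in> (\<lambda>j. \<bar>v $ j\<bar>) ` {..<n}" using n0 by (intro Max_in) auto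
    then obtain i where "i < n" "\<bar>v $ i\<bar> = Max ((\<lambda>j. \<bar>v $ j\<bar>) ` {..<n})" by auto
    then show thesis by (intro that[of i]) (auto intro!: Max_ge)
  qed
  have vi: "v $ i \<noteq> 0"
  proof
    assume "v $ i = 0"
    then have "v $ j = 0" if "j < n" for j using mx[OF that] by simp
    then show False using v by (metis carrier_vecD eq_vecI index_zero_vec)
  qed
  have "(?L *\<^sub>v v) $ i = (\<Sum>j<n. ?L $$ (i, j) * v $ j)"
    using laplacian_carrier[of n E] v i by (auto simp: scalar_prod_def lessThan_atLeast0 intro!: sum.cong)
  then have "r * v $ i = (\<Sum>j<n. ?L $$ (i, j) * v $ j)" using Lv v i by simp
  then have "r * (v $ i)\<^sup>2 = (\<Sum>j<n. ?L $$ (i, j) * v $ j) * v $ i"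
    by (simp add: power2_eq_square)
  also have "\<dots> = (\<Sum>j<n. ?L $$ (i, j) * (v $ j * v $ i)) - (\<Sum>j<n. ?L $$ (i, j)) * (v $ i)\<^sup>2"
    using laplacian_row_sums(1)[OF E i] by (simp add: sum_distrib_right mult.assoc)
  also have "\<dots> = (\<Sum>j<n. ?L $$ (i, j) * (v $ j * v $ i - (v $ i)\<^sup>2))"
    by (simp add: sum_distrib_right sum_subtractf right_diff_distrib)
  also have "\<dots> \<ge> 0"
  proof (rule sum_nonneg)
    fix j assume "j \<in> {..<n}"
    then have j: "j < n" by simp
    have "v $ j * v $ i \<le> \<bar>v $ j\<bar> * \<bar>v $ i\<bar>" by (metis abs_ge_self abs_mult)
    also have "\<dots> \<le> \<bar>v $ i\<bar> * \<bar>v $ i\<bar>" using mx[OF j] by (intro mult_right_mono) auto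
    finally have "v $ j * v $ i \<le> (v $ i)\<^sup>2" by (simp add: power2_eq_square)
    \<comment> \<open>Off the diagonal both factors are at most 0; for \<open>j = i\<close> the
      second one vanishes.\<close>
    then show "0 \<le> ?L $$ (i, j) * (v $ j * v $ i - (v $ i)\<^sup>2)"
      using i j by (auto simp: laplacian_entry power2_eq_square)
  qed
  finally show ?thesis using vi by (simp add: zero_le_mult_iff)
qed

lemma laplacian_eigenvalue_zero:
  assumes E: "E \<subseteq> all_edges n" and n: "n > 0"
  shows "eigenvalue (laplacian n E) 0"
proof -
  let ?v = "vec n (\<lambda>_. 1::real)"
  have "laplacian n E *\<^sub>v ?v = 0 \<cdot>\<^sub>v ?v"
  proof (rule eq_vecI)
    fix i assume "i < dim_vec (0 \<cdot>\<^sub>v ?v)"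
    then have i: "i < n" by simp
    have "(laplacian n E *\<^sub>v ?v) $ i = (\<Sum>j<n. laplacian n E $$ (i, j))"
      using laplacian_carrier[of n E] i by (auto simp: scalar_prod_def lessThan_atLeast0 intro!: sum.cong)
    then show "(laplacian n E *\<^sub>v ?v) $ i = (0 \<cdot>\<^sub>v ?v) $ i"
      using laplacian_row_sums(1)[OF E i] i by simp
  qed (use laplacian_carrier[of n E] in auto)
  moreover have "?v \<noteq> 0\<^sub>v n" using n by (metis index_vec index_zero_vec(1) zero_neq_one)
  ultimately show ?thesis
    unfolding eigenvalue_def eigenvector_def using laplacian_carrier[of n E] by (intro exI[of _ ?v]) auto
qed

text \<open>All eigenvalues are nonnegative and 0 is among them, so the sorted list starts with 0.
  Dropping this entry changes neither power sum, so both remain traces.\<close>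

lemma laplacian_spectrum:
  assumes E: "E \<subseteq> all_edges n" and n: "n > 0"
  obtains xs where "eigenvalues_sorted (laplacian n E) = 0 # xs" "length xs = n - 1" "sorted xs"
    "\<And>x. x \<in> set xs \<Longrightarrow> x \<ge> 0"
    "sum_list xs = (\<Sum>i<n. real (degree_in E i))"
    "(\<Sum>x\<leftarrow>xs. x\<^sup>2) = (\<Sum>i<n. (real (degree_in E i))\<^sup>2 + real (degree_in E i))"
proof -
  let ?L = "laplacian n E"
  note L = laplacian_carrier[of n E]
  have sym: "?L $$ (i, j) = ?L $$ (j, i)" if "i < n" "j < n" for i j
    using that by (auto simp: laplacian_entry insert_commute)
  obtain rs where rs: "char_poly ?L = (\<Prod>r\<leftarrow>rs. [:- r, 1:])" "length rs = n"
    using symmetric_mat_char_poly_splits[OF L sym] by blast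
  have root: "eigenvalue ?L r \<longleftrightarrow> r \<in> set rs" for r
    unfolding eigenvalue_root_char_poly[OF L] rs(1) poly_prod_list by (auto simp: prod_list_zero_iff)
  have nonneg: "r \<ge> 0" if "r \<in> set rs" for r
    using laplacian_eigenvalue_nonneg[OF E] that root by blast
  have zero: "0 \<in> set rs" using laplacian_eigenvalue_zero[OF E n] root by blast
  obtain x xs where sort: "sort rs = x # xs"
    using rs(2) n by (cases "sort rs") (auto dest!: arg_cong[of _ _ length])
  have set: "set (x # xs) = set rs" by (metis sort set_sort)
  have srt: "sorted (x # xs)" by (metis sort sorted_sort)
  have "x \<le> 0" using srt zero set by auto
  moreover have "x \<ge> 0" using nonneg set by auto
  ultimately have x: "x = 0" by simp
  have mset: "mset rs = mset (x # xs)" by (metis sort mset_sort)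
  have sums: "sum_list (map f rs) = f 0 + sum_list (map f xs)" for f :: "real \<Rightarrow> real"
    using mset x by (metis mset_map sum_mset_sum_list list.simps(9) sum_list.Cons)
  have tr: "mat_trace ?L = (\<Sum>i<n. real (degree_in E i))"
    using L by (auto simp: mat_trace_def laplacian_entry intro!: sum.cong)
  have "(?L * ?L) $$ (i, i) = (real (degree_in E i))\<^sup>2 + real (degree_in E i)" if "i < n" for i
  proof -
    have "(?L * ?L) $$ (i, i) = (\<Sum>j<n. ?L $$ (i, j) * ?L $$ (j, i))"
      using L that by (auto simp: scalar_prod_def lessThan_atLeast0 intro!: sum.cong)
    also have "\<dots> = (\<Sum>j<n. (?L $$ (i, j))\<^sup>2)"
      using sym that by (intro sum.cong refl) (simp add: power2_eq_square)
    finally show ?thesis using laplacian_row_sums(2)[OF E that] by simp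
  qed
  then have tr2: "mat_trace (?L * ?L) = (\<Sum>i<n. (real (degree_in E i))\<^sup>2 + real (degree_in E i))"
    using L by (auto simp: mat_trace_def intro!: sum.cong)
  show thesis
  proof (rule that)
    show "eigenvalues_sorted ?L = 0 # xs" using eigenvalues_sorted_of_split[OF rs(1)] sort x by simp
    show "length xs = n - 1" using rs(2) sort by (metis length_sort length_Cons diff_Suc_1)
    show "sorted xs" using srt by simp
    show "\<And>x. x \<in> set xs \<Longrightarrow> x \<ge> 0" using nonneg set by auto
    show "sum_list xs = (\<Sum>i<n. real (degree_in E i))"
      using mat_trace_char_poly_roots(1)[OF L rs(1)] tr sums[of "\<lambda>x. x"] by simp
    show "(\<Sum>x\<leftarrow>xs. x\<^sup>2) = (\<Sum>i<n. (real (degree_in E i))\<^sup>2 + real (degree_in E i))"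
      using mat_trace_char_poly_roots(2)[OF L rs(1)] tr2 sums[of "\<lambda>x. x\<^sup>2"] by simp
  qed
qed

section \<open>Bounds for the algebraic connectivity in terms of the missing edges\<close>

lemma sum_list_squared_le:
  fixes ys :: "real list"
  shows "(sum_list ys)\<^sup>2 \<le> real (length ys) * (\<Sum>y\<leftarrow>ys. y\<^sup>2)"
  using sum_squared_le_sum_of_squares[of "\<lambda>i. ys ! i" "{..<length ys}"]
  by (simp add: sum_list_sum_nth[of ys] sum_list_sum_nth[of "map _ ys"] lessThan_atLeast0 mult.commute)

text \<open>
  The numbers \<open>n - \<lambda>\<close> are the nontrivial Laplacian eigenvalues of the complement \<open>C\<close>, with sum
  \<open>2 |C|\<close> and sum of squares \<open>K\<close>.
\<close>
lemma alg_conn_bounds: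
  fixes n :: nat and E :: "nat set set"
  assumes n: "n \<ge> 2" and E: "E \<subseteq> all_edges n"
  defines "C \<equiv> all_edges n - E" and "X \<equiv> alg_conn n E"
  defines "K \<equiv> (\<Sum>i<n. (real (degree_in C i))\<^sup>2) + 2 * real (card C)"
  shows "0 \<le> X"
    and "(real n - X)\<^sup>2 \<le> K"
    and "(real n - 1) * X\<^sup>2 \<le> K + (real n)\<^sup>2 * (real n - 1) - 4 * real n * real (card C)"
    and "(2 * real (card C) - (real n - X))\<^sup>2 \<le> (real n - 2) * (K - (real n - X)\<^sup>2)"
proof -
  obtain xs where xs: "eigenvalues_sorted (laplacian n E) = 0 # xs" "length xs = n - 1" "sorted xs"
    "\<And>x. x \<in> set xs \<Longrightarrow> x \<ge> 0"
    "sum_list xs = (\<Sum>i<n. real (degree_in E i))"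
    "(\<Sum>x\<leftarrow>xs. x\<^sup>2) = (\<Sum>i<n. (real (degree_in E i))\<^sup>2 + real (degree_in E i))"
    by (rule laplacian_spectrum[OF E]) (use n in auto)
  \<comment> \<open>\<open>alg_conn\<close> is entry 1 of the sorted spectrum, hence the head and a
    least element of \<open>xs\<close>.\<close>
  obtain ys where Xys: "xs = X # ys"
    using xs(1,2) n by (cases xs) (auto simp: X_def alg_conn_def)
  have len: "real (length ys) = real n - 2" using xs(2) Xys n by auto
  show X0: "0 \<le> X" using xs(4) Xys by simp
  have ge: "X \<le> y" if "y \<in> set ys" for y using xs(3) Xys that by simp
  have C: "C \<subseteq> all_edges n" by (simp add: C_def)
  have finE: "finite (all_edges n)" by (rule finite_all_edges)
  have deg: "real (degree_in E i) = real n - 1 - real (degree_in C i)" if "i < n" for i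
  proof -
    have "{e \<in> all_edges n. i \<in> e} = {e \<in> E. i \<in> e} \<union> {e \<in> C. i \<in> e}" using E by (auto simp: C_def)
    moreover have "card \<dots> = degree_in E i + degree_in C i"
      unfolding degree_in_def
      by (rule card_Un_disjoint) (use finE E in \<open>auto simp: C_def intro: finite_subset\<close>)
    ultimately have "n - 1 = degree_in E i + degree_in C i" using card_incident_edges[OF that] by simp
    then show ?thesis using that by linarith
  qed
  have degC: "(\<Sum>i<n. real (degree_in C i)) = 2 * real (card C)"
    unfolding degree_in_def using handshake[OF C] by (metis of_nat_mult of_nat_numeral of_nat_sum)
  have s1: "sum_list xs = real n * (real n - 1) - 2 * real (card C)"
    unfolding xs(5) by (simp add: deg sum_subtractf degC right_diff_distrib)
  have "(real (degree_in E i))\<^sup>2 + real (degree_in E i)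
    = real n * (real n - 1) - (2 * real n - 1) * real (degree_in C i) + (real (degree_in C i))\<^sup>2" if "i < n" for i
    unfolding deg[OF that] by (simp add: power2_eq_square algebra_simps)
  then have "(\<Sum>x\<leftarrow>xs. x\<^sup>2)
    = (\<Sum>i<n. real n * (real n - 1) - (2 * real n - 1) * real (degree_in C i) + (real (degree_in C i))\<^sup>2)"
    unfolding xs(6) by (intro sum.cong) auto
  also have "\<dots> = real n * (real n * (real n - 1)) - (2 * real n - 1) * (2 * real (card C)) + (K - 2 * real (card C))"
    unfolding sum.distrib sum_subtractf sum_distrib_left[symmetric] degC K_def by (simp add: right_diff_distrib)
  finally have s2: "(\<Sum>x\<leftarrow>xs. x\<^sup>2) = (real n)\<^sup>2 * (real n - 1) - 4 * real n * real (card C) + K"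
    by (simp add: power2_eq_square algebra_simps)
  \<comment> \<open>These are the nontrivial complement eigenvalues other than \<open>n - X\<close>.
    Their power sums \<open>z1\<close> and \<open>z2\<close> give the second bound by nonnegativity
    and the fourth by Cauchy-Schwarz.\<close>
  define zs where "zs = map (\<lambda>y. real n - y) ys"
  have lz: "real (length zs) = real n - 2" by (simp add: zs_def len)
  have "sum_list (map (\<lambda>y. real n - y) ys) = real (length ys) * real n - sum_list ys"
    by (induction ys) (auto simp: algebra_simps)
  then have z1: "sum_list zs = 2 * real (card C) - (real n - X)"
    using s1 len by (simp add: zs_def Xys algebra_simps)
  have "(\<Sum>z\<leftarrow>map (\<lambda>y. real n - y) ys. z\<^sup>2) = real (length ys) * (real n)\<^sup>2 - 2 * real n * sum_list ys + (\<Sum>y\<leftarrow>ys. y\<^sup>2)"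
    by (induction ys) (auto simp: algebra_simps power2_eq_square)
  moreover have "sum_list ys = real n * (real n - 1) - 2 * real (card C) - X" using s1 by (simp add: Xys)
  moreover have "(\<Sum>y\<leftarrow>ys. y\<^sup>2) = (real n)\<^sup>2 * (real n - 1) - 4 * real n * real (card C) + K - X\<^sup>2"
    using s2 by (simp add: Xys)
  ultimately have z2: "(\<Sum>z\<leftarrow>zs. z\<^sup>2) = K - (real n - X)\<^sup>2"
    unfolding zs_def len by (simp only:) (simp add: algebra_simps power2_eq_square)
  have "(\<Sum>z\<leftarrow>zs. z\<^sup>2) \<ge> 0" by (intro sum_list_nonneg) auto
  then show "(real n - X)\<^sup>2 \<le> K" using z2 by simp
  show "(2 * real (card C) - (real n - X))\<^sup>2 \<le> (real n - 2) * (K - (real n - X)\<^sup>2)"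
    using sum_list_squared_le[of zs] z1 z2 lz by simp
  \<comment> \<open>Third bound: \<open>X\<close> is nonnegative and least, so its square is at most
    the mean of the squares of \<open>xs\<close>.\<close>
  have "(\<Sum>y\<leftarrow>ys. X\<^sup>2) \<le> (\<Sum>y\<leftarrow>ys. y\<^sup>2)"
    by (rule sum_list_mono) (use ge X0 in \<open>auto intro: power_mono\<close>)
  then have "(real n - 2) * X\<^sup>2 \<le> (\<Sum>y\<leftarrow>ys. y\<^sup>2)" using len by (simp add: sum_list_triv)
  then show "(real n - 1) * X\<^sup>2 \<le> K + (real n)\<^sup>2 * (real n - 1) - 4 * real n * real (card C)"
    using s2 by (simp add: Xys algebra_simps)
qed

section \<open>Lower bounds for the probability\<close>

lemma degree_in_diff_eq: "degree_in (all_edges n - E) i = card ({e \<in> all_edges n. i \<in> e} - E)"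
  unfolding degree_in_def by (rule arg_cong[where f = card]) auto

text \<open>\<open>M\<close> is the number of possible edges. A complement degree counts the missing
  edges in a star of \<open>n - 1\<close> edges.\<close>

lemma expectation_complement_moments:
  fixes n N :: nat and p :: real
  assumes n: "n \<ge> 1" and p: "0 \<le> p" "p \<le> 1"
  defines "U \<equiv> union_gnp n p N" and "Q \<equiv> (1 - p) ^ N" and "M \<equiv> real n * (real n - 1) / 2"
  shows "measure_pmf.expectation U (\<lambda>E. real (card (all_edges n - E))) = M * Q"
    and "measure_pmf.expectation U (\<lambda>E. (real (card (all_edges n - E)))\<^sup>2) = M * Q + M * (M - 1) * Q\<^sup>2"
    and "measure_pmf.expectation U (\<lambda>E. \<Sum>i<n. (real (degree_in (all_edges n - E) i))\<^sup>2)
      = real n * ((real n - 1) * Q + (real n - 1) * (real n - 2) * Q\<^sup>2)"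
proof -
  have "real (2 * card (all_edges n)) = real (n * (n - 1))" by (simp only: card_all_edges)
  then have M: "real (card (all_edges n)) = M" using n by (simp add: M_def)
  show "measure_pmf.expectation U (\<lambda>E. real (card (all_edges n - E))) = M * Q"
    using expectation_missing_edges(1)[OF p, of "all_edges n" n N] by (simp add: U_def Q_def M)
  show "measure_pmf.expectation U (\<lambda>E. (real (card (all_edges n - E)))\<^sup>2) = M * Q + M * (M - 1) * Q\<^sup>2"
    using expectation_missing_edges(2)[OF p, of "all_edges n" n N] by (simp add: U_def Q_def M)
  have "measure_pmf.expectation U (\<lambda>E. \<Sum>i<n. (real (degree_in (all_edges n - E) i))\<^sup>2)
    = (\<Sum>i<n. measure_pmf.expectation U (\<lambda>E. (real (card ({e \<in> all_edges n. i \<in> e} - E)))\<^sup>2))"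
    unfolding degree_in_diff_eq by (rule Bochner_Integration.integral_sum) (simp add: U_def)
  also have "\<dots> = (\<Sum>i<n. (real n - 1) * Q + (real n - 1) * (real n - 2) * Q\<^sup>2)"
  proof (rule sum.cong[OF refl])
    fix i assume "i \<in> {..<n}"
    then have c: "real (card {e \<in> all_edges n. i \<in> e}) = real n - 1"
      using card_incident_edges[of i n] n by simp
    show "measure_pmf.expectation U (\<lambda>E. (real (card ({e \<in> all_edges n. i \<in> e} - E)))\<^sup>2)
      = (real n - 1) * Q + (real n - 1) * (real n - 2) * Q\<^sup>2"
      using expectation_missing_edges(2)[OF p, of "{e \<in> all_edges n. i \<in> e}" n N]
      by (simp add: U_def Q_def c)
  qed
  finally show "measure_pmf.expectation U (\<lambda>E. \<Sum>i<n. (real (degree_in (all_edges n - E) i))\<^sup>2)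
      = real n * ((real n - 1) * Q + (real n - 1) * (real n - 2) * Q\<^sup>2)" by simp
qed

section \<open>From pointwise minorants to probabilities\<close>

text \<open>Every probability bound below comes from a minorant of the indicator whose expectation
  is explicit; the minorant is only tested on genuine edge sets, which carry the
  distribution.\<close>

lemma prob_union_gnp_ge_expectation:
  fixes f :: "nat set set \<Rightarrow> real"
  assumes "\<And>E. E \<subseteq> all_edges n \<Longrightarrow> f E \<le> indicator A E"
  shows "measure_pmf.expectation (union_gnp n p N) f \<le> measure_pmf.prob (union_gnp n p N) A"
proof -
  have "measure_pmf.expectation (union_gnp n p N) f \<le> measure_pmf.expectation (union_gnp n p N) (indicator A)"
  proof (rule integral_mono_AE)
    show "AE E in measure_pmf (union_gnp n p N). f E \<le> indicator A E"
      unfolding AE_measure_pmf_iff using set_pmf_union_gnp[of n p N] assms by (meson PowD subsetD)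
  qed (rule integrable_union_gnp)+
  then show ?thesis by simp
qed

text \<open>Pointwise form of Paley-Zygmund, with \<open>\<beta>\<close> left free for optimization.
  Above the threshold it rests on \<open>0 \<le> (\<beta> * x - 1)\<^sup>2\<close>; below it no term
  on the left is positive.\<close>

lemma indicator_ge_quadratic:
  fixes x \<theta> \<beta> :: real
  assumes "\<beta> \<ge> 0" "\<theta> \<ge> 0"
  shows "2 * \<beta> * (x - \<theta>) - \<beta>\<^sup>2 * x\<^sup>2 \<le> (if \<theta> \<le> x then 1 else 0)"
proof (cases "\<theta> \<le> x")
  case True
  have "0 \<le> (\<beta> * x - 1)\<^sup>2" by simp
  then have "2 * \<beta> * x - \<beta>\<^sup>2 * x\<^sup>2 \<le> 1" by (simp add: power2_eq_square algebra_simps)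
  moreover have "0 \<le> 2 * \<beta> * \<theta>" using assms by simp
  moreover have "2 * \<beta> * (x - \<theta>) = 2 * \<beta> * x - 2 * \<beta> * \<theta>" by (simp add: right_diff_distrib)
  ultimately have "2 * \<beta> * (x - \<theta>) - \<beta>\<^sup>2 * x\<^sup>2 \<le> 1" by linarith
  then show ?thesis using True by simp
next
  case False
  then have "2 * \<beta> * (x - \<theta>) \<le> 0" using assms by (intro mult_nonneg_nonpos) auto
  moreover have "\<beta>\<^sup>2 * x\<^sup>2 \<ge> 0" by simp
  ultimately have "2 * \<beta> * (x - \<theta>) - \<beta>\<^sup>2 * x\<^sup>2 \<le> 0" by linarith
  then show ?thesis using False by simp
qed

text \<open>In the quadratic minorant the connectivity is replaced from below, and its square from
  above, by expressions linear in \<open>k\<close>, its square and \<open>D\<close>, whose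
  expectations are known.\<close>

lemma prob_alg_conn_ge_Paley_Zygmund:
  fixes n N :: nat and p \<theta> :: real
  assumes n: "n \<ge> 3" and p: "0 \<le> p" "p \<le> 1"
  defines "Q \<equiv> (1 - p) ^ N"
  defines "c \<equiv> sqrt (2 * real n * (real n - 2) * (1 - Q) * Q) * sqrt ((real n - 2) / (real n - 1))"
  defines "S \<equiv> real n * (real n - 2) * (1 - Q)\<^sup>2 + 2 * real n * (1 - Q)"
  assumes Q: "0 < Q" "Q < 1" and \<theta>: "0 \<le> \<theta>" "\<theta> \<le> real n * (1 - Q) - c"
  shows "(real n * (1 - Q) - c - \<theta>)\<^sup>2 / S
    \<le> measure_pmf.prob (union_gnp n p N) {E. alg_conn n E \<ge> \<theta>}"
proof -
  let ?n = "real n" and ?U = "union_gnp n p N"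
  define \<mu> where "\<mu> = ?n * (1 - Q) - c"
  \<comment> \<open>The maximizer of
    \<open>2 * \<beta> * (\<mu> - \<theta>) - \<beta>\<^sup>2 * S\<close>.\<close>
  define \<beta> where "\<beta> = (\<mu> - \<theta>) / S"
  have n3: "?n \<ge> 3" using n by simp
  have S: "S > 0" unfolding S_def using Q n3 by (intro add_nonneg_pos mult_nonneg_nonneg) auto
  have \<beta>: "\<beta> \<ge> 0" using \<theta> S by (simp add: \<beta>_def \<mu>_def)
  have c: "c > 0" unfolding c_def using Q n3 by simp
  have c2: "c\<^sup>2 = 2 * ?n * (?n - 2) * (1 - Q) * Q * ((?n - 2) / (?n - 1))"
    unfolding c_def power_mult_distrib using Q n3 by simp
  define k where "k E = real (card (all_edges n - E))" for E
  define D where "D E = (\<Sum>i<n. (real (degree_in (all_edges n - E) i))\<^sup>2)" for E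
  \<comment> \<open>\<open>V\<close> is the variance of the nontrivial eigenvalues, unchanged when
    passing to the complement; \<open>X2\<close> is the mean of their squares.\<close>
  define V where "V E = (D E + 2 * k E) / (?n - 1) - (2 / (?n - 1))\<^sup>2 * (k E)\<^sup>2" for E
  define X2 where "X2 E = (D E + 2 * k E) / (?n - 1) + ?n\<^sup>2 - 4 * ?n / (?n - 1) * k E" for E
  define f where "f E = 2 * \<beta> * (?n - 2 / (?n - 1) * k E - (c / 2 + (?n - 2) / (2 * c) * V E) - \<theta>) - \<beta>\<^sup>2 * X2 E" for E
  have "f E \<le> indicator {E. alg_conn n E \<ge> \<theta>} E" if E: "E \<subseteq> all_edges n" for E
  proof -
    define X where "X = alg_conn n E"
    have "n \<ge> 2" using n by simp
    note b = alg_conn_bounds[OF this E, folded X_def, folded k_def D_def]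
    have "X\<^sup>2 \<le> X2 E"
    proof -
      have "(?n - 1) * X2 E = D E + 2 * k E + ?n\<^sup>2 * (?n - 1) - 4 * ?n * k E"
        using n3 unfolding X2_def by (simp add: divide_simps)
      then have "(?n - 1) * X\<^sup>2 \<le> (?n - 1) * X2 E" using b(3) by simp
      then show ?thesis using n3 by simp
    qed
    then have X2: "\<beta>\<^sup>2 * X\<^sup>2 \<le> \<beta>\<^sup>2 * X2 E" by (intro mult_left_mono) auto
    \<comment> \<open>The mean of the nontrivial eigenvalues minus the smallest one. The bound on
      its square is the fourth spectral bound after clearing the denominators
      \<open>n - 1\<close>.\<close>
    define a where "a = ?n - X - 2 / (?n - 1) * k E"
    have "a\<^sup>2 \<le> (?n - 2) * V E"
    proof -
      define m where "m = ?n - 1"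
      have m: "m > 0" using n3 by (simp add: m_def)
      have a: "m * a = m * (?n - X) - 2 * k E" using m by (simp add: a_def m_def field_simps)
      have V: "m\<^sup>2 * V E = m * (D E + 2 * k E) - 4 * (k E)\<^sup>2"
        using m unfolding V_def m_def[symmetric] by (simp add: power2_eq_square field_simps)
      have "m\<^sup>2 * a\<^sup>2 = (m * (?n - X) - 2 * k E)\<^sup>2" using a by (metis power_mult_distrib)
      also have "\<dots> = m * ((2 * k E - (?n - X))\<^sup>2 + (m - 1) * (?n - X)\<^sup>2) - 4 * (m - 1) * (k E)\<^sup>2"
        by (simp add: power2_eq_square algebra_simps)
      also have "\<dots> \<le> m * ((?n - 2) * (D E + 2 * k E)) - 4 * (m - 1) * (k E)\<^sup>2"
      proof -
        have "(2 * k E - (?n - X))\<^sup>2 + (m - 1) * (?n - X)\<^sup>2 \<le> (?n - 2) * (D E + 2 * k E)"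
          using b(4) by (simp add: m_def algebra_simps)
        then show ?thesis using m by (simp add: mult_left_mono)
      qed
      also have "\<dots> = (?n - 2) * (m\<^sup>2 * V E)"
        unfolding V by (simp add: m_def algebra_simps)
      also have "\<dots> = m\<^sup>2 * ((?n - 2) * V E)" by simp
      finally show ?thesis using m by simp
    qed
    then have "(?n - 2) / (2 * c) * V E \<ge> a\<^sup>2 / (2 * c)" using c by (simp add: divide_simps)
    \<comment> \<open>Young's inequality, sharp at \<open>a = c\<close>, trades the square root of
      \<open>V\<close> for a term linear in \<open>V\<close>.\<close>
    moreover have "a \<le> c / 2 + a\<^sup>2 / (2 * c)"
    proof -
      have "0 \<le> (a - c)\<^sup>2" by simp
      then have "2 * (a * c) \<le> c\<^sup>2 + a\<^sup>2" by (simp add: power2_eq_square algebra_simps)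
      then show ?thesis using c by (simp add: field_simps power2_eq_square)
    qed
    ultimately have "?n - 2 / (?n - 1) * k E - (c / 2 + (?n - 2) / (2 * c) * V E) - \<theta> \<le> X - \<theta>"
      by (simp add: a_def)
    then have "2 * \<beta> * (?n - 2 / (?n - 1) * k E - (c / 2 + (?n - 2) / (2 * c) * V E) - \<theta>) \<le> 2 * \<beta> * (X - \<theta>)"
      using \<beta> by (intro mult_left_mono) auto
    then have "f E \<le> 2 * \<beta> * (X - \<theta>) - \<beta>\<^sup>2 * X\<^sup>2" unfolding f_def using X2 by linarith
    also have "\<dots> \<le> (if \<theta> \<le> X then 1 else 0)"
      using indicator_ge_quadratic[OF \<beta> \<theta>(1)] .
    finally show ?thesis by (auto simp: X_def indicator_def split: if_splits)
  qed
  then have "measure_pmf.expectation ?U f \<le> measure_pmf.prob ?U {E. alg_conn n E \<ge> \<theta>}"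
    by (rule prob_union_gnp_ge_expectation)
  moreover have "measure_pmf.expectation ?U f = 2 * \<beta> * (\<mu> - \<theta>) - \<beta>\<^sup>2 * S"
  proof -
    have "n \<ge> 1" using n by simp
    note mom = expectation_complement_moments[OF this p, of N, folded Q_def, folded k_def D_def]
    let ?M = "?n * (?n - 1) / 2"
    have V: "measure_pmf.expectation ?U V = 2 * ?n * (1 - Q) * Q * ((?n - 2) / (?n - 1))"
    proof -
      have "measure_pmf.expectation ?U V =
        (?n * ((?n - 1) * Q + (?n - 1) * (?n - 2) * Q\<^sup>2) + 2 * (?M * Q)) / (?n - 1)
        - (2 / (?n - 1))\<^sup>2 * (?M * Q + ?M * (?M - 1) * Q\<^sup>2)"
        unfolding V_def by (simp add: mom)
      also have "\<dots> = 2 * ?n * (1 - Q) * Q * ((?n - 2) / (?n - 1))"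
        using n3 by (simp add: divide_simps) (simp add: power2_eq_square algebra_simps)
      finally show ?thesis .
    qed
    have X2: "measure_pmf.expectation ?U X2 = S"
    proof -
      have "measure_pmf.expectation ?U X2 =
        (?n * ((?n - 1) * Q + (?n - 1) * (?n - 2) * Q\<^sup>2) + 2 * (?M * Q)) / (?n - 1)
        + ?n\<^sup>2 - 4 * ?n / (?n - 1) * (?M * Q)"
        unfolding X2_def by (simp add: mom)
      also have "\<dots> = S"
        using n3 unfolding S_def by (simp add: divide_simps) (simp add: power2_eq_square algebra_simps)
      finally show ?thesis .
    qed
    \<comment> \<open>\<open>c\<^sup>2\<close> is \<open>n - 2\<close> times the expected variance,
      so both terms of Young's inequality contribute \<open>c / 2\<close>.\<close>
    have W: "(?n - 2) / (2 * c) * (2 * ?n * (1 - Q) * Q * ((?n - 2) / (?n - 1))) = c / 2"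
    proof -
      have "(?n - 2) / (2 * c) * (2 * ?n * (1 - Q) * Q * r) = 2 * ?n * (?n - 2) * (1 - Q) * Q * r / (2 * c)" for r
        by (simp only: times_divide_eq_left times_divide_eq_right mult_ac)
      then have "(?n - 2) / (2 * c) * (2 * ?n * (1 - Q) * Q * ((?n - 2) / (?n - 1))) = c\<^sup>2 / (2 * c)"
        unfolding c2 .
      then show ?thesis using c by (simp add: power2_eq_square)
    qed
    have "measure_pmf.expectation ?U f =
      2 * \<beta> * (?n - 2 / (?n - 1) * (?M * Q) - (c / 2 + (?n - 2) / (2 * c) * (2 * ?n * (1 - Q) * Q * ((?n - 2) / (?n - 1)))) - \<theta>) - \<beta>\<^sup>2 * S"
      unfolding f_def by (simp add: mom(1) V X2)
    also have "\<dots> = 2 * \<beta> * (?n - 2 / (?n - 1) * (?M * Q) - c - \<theta>) - \<beta>\<^sup>2 * S"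
      unfolding W by simp
    also have "2 / (?n - 1) * (?M * Q) = ?n * Q" using n3 by simp
    also have "?n - ?n * Q - c - \<theta> = \<mu> - \<theta>" by (simp add: \<mu>_def algebra_simps)
    finally show ?thesis .
  qed
  moreover have "2 * \<beta> * (\<mu> - \<theta>) - \<beta>\<^sup>2 * S = (\<mu> - \<theta>)\<^sup>2 / S"
    using S by (simp add: \<beta>_def power2_eq_square)
  ultimately show ?thesis by (simp add: \<mu>_def)
qed

section \<open>The small cases n = 3 and n = 4\<close>

text \<open>The minorant is 1 minus the number of pairs of missing edges, which is at most 0 once
  two edges are missing. The triangle has three pairs of edges.\<close>

lemma prob_alg_conn_ge_3:
  fixes N :: nat and p :: real
  assumes p: "0 \<le> p" "p \<le> 1"
  shows "1 - 3 * ((1 - p) ^ N)\<^sup>2 \<le> measure_pmf.prob (union_gnp 3 p N) {E. alg_conn 3 E \<ge> 1}"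
proof -
  define k where "k E = real (card (all_edges 3 - E))" for E
  have "1 - ((k E)\<^sup>2 - k E) / 2 \<le> indicator {E. alg_conn 3 E \<ge> 1} E" if E: "E \<subseteq> all_edges 3" for E
  proof (cases "card (all_edges 3 - E) \<le> 1")
    case True
    let ?C = "all_edges 3 - E"
    have sq: "(\<Sum>i<3. (degree_in ?C i)\<^sup>2) \<le> (card ?C)\<^sup>2 + card ?C"
      unfolding degree_in_def by (rule sum_degree_squares_le) auto
    have "(\<Sum>i<3. (real (degree_in ?C i))\<^sup>2) \<le> (k E)\<^sup>2 + k E"
      unfolding k_def using of_nat_mono[OF sq, where 'a = real] by simp
    moreover have "0 \<le> k E" "k E \<le> 1" using True by (auto simp: k_def)
    moreover from this have "(k E)\<^sup>2 \<le> 1" by (simp add: power_le_one)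
    \<comment> \<open>The squared degrees contribute at most 2 and the doubled count of missing
      edges at most 2.\<close>
    ultimately have "(3 - alg_conn 3 E)\<^sup>2 \<le> 2\<^sup>2"
      using alg_conn_bounds(2)[of 3 E, OF _ E, folded k_def] by simp
    then have "3 - alg_conn 3 E \<le> 2" by (rule power2_le_imp_le) simp
    moreover have "0 \<le> (k E)\<^sup>2 - k E" 
    proof -
      have "card ?C = 0 \<or> card ?C = 1" using True by linarith
      then show ?thesis by (auto simp: k_def)
    qed
    ultimately show ?thesis by simp
  next
    case False
    then have "k E \<ge> 2" by (simp add: k_def)
    then have "2 * 1 \<le> k E * (k E - 1)" by (intro mult_mono) auto
    then have "1 - ((k E)\<^sup>2 - k E) / 2 \<le> 0" by (simp add: power2_eq_square algebra_simps)
    then show ?thesis by (smt (verit) indicator_pos_le)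
  qed
  then have "measure_pmf.expectation (union_gnp 3 p N) (\<lambda>E. 1 - ((k E)\<^sup>2 - k E) / 2)
    \<le> measure_pmf.prob (union_gnp 3 p N) {E. alg_conn 3 E \<ge> 1}"
    by (rule prob_union_gnp_ge_expectation)
  moreover have "measure_pmf.expectation (union_gnp 3 p N) (\<lambda>E. 1 - ((k E)\<^sup>2 - k E) / 2)
    = 1 - 3 * ((1 - p) ^ N)\<^sup>2"
    using expectation_complement_moments(1,2)[of 3 p N, folded k_def] p by simp
  ultimately show ?thesis by simp
qed

text \<open>Here two missing edges are still harmless. The divisor 6 makes the minorant vanish at
  three missing edges, and the 30 ordered pairs of distinct edges then give the constant 5.\<close>

lemma prob_alg_conn_ge_4:
  fixes N :: nat and p :: real
  assumes p: "0 \<le> p" "p \<le> 1"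
  shows "1 - 5 * ((1 - p) ^ N)\<^sup>2 \<le> measure_pmf.prob (union_gnp 4 p N) {E. alg_conn 4 E \<ge> 2 - sqrt 2}"
proof -
  define k where "k E = real (card (all_edges 4 - E))" for E
  have "1 - ((k E)\<^sup>2 - k E) / 6 \<le> indicator {E. alg_conn 4 E \<ge> 2 - sqrt 2} E" if E: "E \<subseteq> all_edges 4" for E
  proof (cases "card (all_edges 4 - E) \<le> 2")
    case True
    let ?C = "all_edges 4 - E"
    have sq: "(\<Sum>i<4. (degree_in ?C i)\<^sup>2) \<le> (card ?C)\<^sup>2 + card ?C"
      unfolding degree_in_def by (rule sum_degree_squares_le) auto
    have "(\<Sum>i<4. (real (degree_in ?C i))\<^sup>2) \<le> (k E)\<^sup>2 + k E"
      unfolding k_def using of_nat_mono[OF sq, where 'a = real] by simp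
    moreover have k: "0 \<le> k E" "k E \<le> 2" using True by (auto simp: k_def)
    moreover have "(k E)\<^sup>2 \<le> 2\<^sup>2" using k by (intro power_mono)
    \<comment> \<open>The squared degrees contribute at most 6 and the doubled count of missing
      edges at most 4.\<close>
    ultimately have "(4 - alg_conn 4 E)\<^sup>2 \<le> 10"
      using alg_conn_bounds(2)[of 4 E, OF _ E, folded k_def] by simp
    also have "10 \<le> (2 + sqrt 2)\<^sup>2"
      using sqrt2_less_2 real_le_rsqrt[of 1 2] by (simp add: power2_sum)
    finally have "4 - alg_conn 4 E \<le> 2 + sqrt 2" by (rule power2_le_imp_le) simp
    moreover have "0 \<le> (k E)\<^sup>2 - k E" 
    proof -
      have "card ?C = 0 \<or> card ?C = 1 \<or> card ?C = 2" using True by linarith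
      then show ?thesis by (auto simp: k_def)
    qed
    ultimately show ?thesis by simp
  next
    case False
    then have "k E \<ge> 3" by (simp add: k_def)
    then have "3 * 2 \<le> k E * (k E - 1)" by (intro mult_mono) auto
    then have "1 - ((k E)\<^sup>2 - k E) / 6 \<le> 0" by (simp add: power2_eq_square algebra_simps)
    then show ?thesis by (smt (verit) indicator_pos_le)
  qed
  then have "measure_pmf.expectation (union_gnp 4 p N) (\<lambda>E. 1 - ((k E)\<^sup>2 - k E) / 6)
    \<le> measure_pmf.prob (union_gnp 4 p N) {E. alg_conn 4 E \<ge> 2 - sqrt 2}"
    by (rule prob_union_gnp_ge_expectation)
  moreover have "measure_pmf.expectation (union_gnp 4 p N) (\<lambda>E. 1 - ((k E)\<^sup>2 - k E) / 6)
    = 1 - 5 * ((1 - p) ^ N)\<^sup>2"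
    using expectation_complement_moments(1,2)[of 4 p N, folded k_def] p by simp
  ultimately show ?thesis by simp
qed

section \<open>The threshold for the number of graphs\<close>

text \<open>
  The argument of the logarithm in \<open>N_min\<close> is the smaller root of
  \<open>(n (1 - Q) - \<lambda>\<^sub>m\<^sub>i\<^sub>n)\<^sup>2 = 2 n (n - 2) Q (1 - Q)\<close>; only the lower bound \<open>tau n \<ge> 2 n (n - 2)\<close> is
  needed to estimate it.
\<close>
lemma N_min_imp_power_le:
  fixes n N :: nat and p :: real
  assumes n: "n \<ge> 3" and p: "0 < p" "p < 1" and N: "real N \<ge> N_min n p"
  shows "(1 - p) ^ N * (3 * real n - 4) \<le> real n - 2 + 2 * cos (pi / real n)"
proof -
  let ?n = "real n" and ?Q = "(1 - p) ^ N"
  define u where "u = 1 - cos (pi / ?n)"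
  have n3: "?n \<ge> 3" using n by simp
  have "cos (pi / 3) \<le> cos (pi / ?n)"
    using n3 by (intro cos_monotone_0_pi_le) (auto intro!: divide_left_mono simp: field_simps)
  then have u: "0 \<le> u" "u \<le> 1 / 2" by (auto simp: u_def cos_60)
  have cos: "cos (pi / ?n) = 1 - u" by (simp add: u_def)
  define D where "D = 16 * ?n\<^sup>2 * (?n - 2) * u + 32 * ?n * (2 - ?n) * u\<^sup>2 + 4 * ?n\<^sup>2 * (?n - 2)\<^sup>2"
  have tau: "tau n = sqrt D" unfolding tau_def D_def u_def by simp
  define b where "b = 4 * ?n\<^sup>2 - 4 * ?n - 4 * ?n * u"
  have num: "4 * ?n\<^sup>2 + 4 * ?n * cos (pi / ?n) - tau n - 8 * ?n = b - tau n"
    unfolding b_def cos by (simp add: algebra_simps)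
  have den: "6 * ?n\<^sup>2 - 8 * ?n = 2 * ?n * (3 * ?n - 4)"
    by (simp add: power2_eq_square algebra_simps)
  \<comment> \<open>This factorization makes the argument of the logarithm positive, so that
    \<open>ln\<close> can be inverted.\<close>
  have "b\<^sup>2 - D = 4 * ?n * (3 * ?n - 4) * (?n - 2 * u)\<^sup>2"
    unfolding b_def D_def by (simp add: power2_eq_square algebra_simps)
  also have "\<dots> > 0" using n3 u by simp
  finally have "D < b\<^sup>2" by simp
  moreover have "b \<ge> 0"
  proof -
    have "0 \<le> 4 * ?n * (?n - 1 - u)" using n3 u by (intro mult_nonneg_nonneg) auto
    then show ?thesis by (simp add: b_def power2_eq_square algebra_simps)
  qed
  ultimately have "tau n < b" unfolding tau using real_sqrt_less_mono[of D "b\<^sup>2"] by simp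
  then have pos: "(b - tau n) / (2 * ?n * (3 * ?n - 4)) > 0" using n3 by simp
  have "(2 * ?n * (?n - 2))\<^sup>2 \<le> D"
  proof -
    have "D - (2 * ?n * (?n - 2))\<^sup>2 = 16 * ?n * (?n - 2) * u * (?n - 2 * u)"
      unfolding D_def by (simp add: power2_eq_square algebra_simps)
    also have "\<dots> \<ge> 0" using n3 u by simp
    finally show ?thesis by simp
  qed
  then have tau_ge: "2 * ?n * (?n - 2) \<le> tau n" unfolding tau by (rule real_le_rsqrt)
  have ln: "ln (1 - p) < 0" using p by simp
  have "1 / ln (1 - p) * ln ((b - tau n) / (2 * ?n * (3 * ?n - 4))) \<le> real N"
    using N unfolding N_min_def num den .
  \<comment> \<open>\<open>ln (1 - p)\<close> is negative, so clearing it reverses the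
    inequality.\<close>
  then have "real N * ln (1 - p) \<le> ln ((b - tau n) / (2 * ?n * (3 * ?n - 4)))"
    using ln by (simp add: field_simps)
  then have "ln ?Q \<le> ln ((b - tau n) / (2 * ?n * (3 * ?n - 4)))"
    using p by (simp add: ln_realpow)
  then have "?Q \<le> (b - tau n) / (2 * ?n * (3 * ?n - 4))"
    using pos p by simp
  then have "?Q * (2 * ?n * (3 * ?n - 4)) \<le> b - tau n"
    using n3 by (simp add: pos_le_divide_eq)
  also have "\<dots> \<le> b - 2 * ?n * (?n - 2)" using tau_ge by simp
  also have "\<dots> = 2 * ?n * (?n - 2 + 2 * cos (pi / ?n))"
    unfolding b_def cos by (simp add: power2_eq_square algebra_simps)
  finally have "2 * ?n * (?Q * (3 * ?n - 4)) \<le> 2 * ?n * (?n - 2 + 2 * cos (pi / ?n))"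
    by (simp add: mult_ac)
  then show ?thesis using n3 by simp
qed

section \<open>Estimates for n at least 5\<close>

lemma two_one_minus_cos_le: "2 * (1 - cos x) \<le> (x::real)\<^sup>2"
proof -
  have "\<bar>sin (x / 2)\<bar> \<le> \<bar>x / 2\<bar>" by (rule abs_sin_x_le_abs_x)
  then have "(sin (x / 2))\<^sup>2 \<le> (x / 2)\<^sup>2" by (simp only: abs_le_square_iff)
  moreover have "cos x = 1 - 2 * (sin (x / 2))\<^sup>2" using cos_double_sin[of "x / 2"] by simp
  ultimately show ?thesis by (simp add: power_divide)
qed

text \<open>At \<open>pi / 5\<close> the triple angle is \<open>pi\<close> minus the double angle,
  which gives a cubic with the factor \<open>?c + 1\<close>. The case \<open>n = 5\<close> needs
  this precision: bounding \<open>lambda_min n\<close> by \<open>(pi / n)\<^sup>2\<close> is too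
  weak there.\<close>

lemma cos_pi_5: "4 * (cos (pi / 5))\<^sup>2 - 2 * cos (pi / 5) - 1 = 0"
proof -
  let ?c = "cos (pi / 5)"
  have "cos (3 * (pi / 5)) = cos (pi - 2 * (pi / 5))" by (rule arg_cong[where f = cos]) simp
  also have "\<dots> = - cos (2 * (pi / 5))" by (rule cos_pi_minus)
  finally have "4 * ?c ^ 3 - 3 * ?c = - (2 * ?c\<^sup>2 - 1)"
    by (simp only: cos_treble_cos cos_double_cos)
  then have "(?c + 1) * (4 * ?c\<^sup>2 - 2 * ?c - 1) = 0"
    by (simp add: power3_eq_cube power2_eq_square algebra_simps)
  moreover have "?c > 0" by (rule cos_gt_zero) auto
  ultimately show ?thesis by simp
qed

text \<open>Expanding the product form of the claimed bound leaves a cross term proportional to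
  \<open>lambda_min n / (n * (1 - Q))\<close>. The factor \<open>sqrt ((n - 2) / (n - 1))\<close>
  gained in Paley-Zygmund has to absorb it, which is this inequality.\<close>

lemma lambda_min_gap:
  fixes n :: nat and Q :: real
  assumes n: "n \<ge> 5" and Q: "Q \<ge> 0" "Q * (3 * real n - 4) \<le> real n - 2 + 2 * cos (pi / real n)"
  shows "Q < 1" "lambda_min n / (real n * (1 - Q)) \<le> 1 - sqrt ((real n - 2) / (real n - 1))"
proof -
  let ?n = "real n"
  have n5: "?n \<ge> 5" using n by simp
  \<comment> \<open>\<open>Q * (3 * ?n - 4)\<close> is at most \<open>?n\<close>, which is less than
    half of \<open>3 * ?n - 4\<close> once \<open>?n > 4\<close>.\<close>
  have Qh: "Q \<le> 1 / 2"
  proof (rule ccontr)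
    assume "\<not> Q \<le> 1 / 2"
    then have "1 / 2 * (3 * ?n - 4) < Q * (3 * ?n - 4)" using n5 by (intro mult_strict_right_mono) auto
    also have "\<dots> \<le> ?n" using Q(2) cos_le_one[of "pi / ?n"] by linarith
    finally show False using n5 by simp
  qed
  then show "Q < 1" by simp
  show "lambda_min n / (?n * (1 - Q)) \<le> 1 - sqrt ((?n - 2) / (?n - 1))"
  proof (cases "n = 5")
    case True
    let ?c = "cos (pi / 5)"
    have c0: "?c > 0" by (rule cos_gt_zero) auto
    have c1: "?c \<le> 0.81"
    proof (rule ccontr)
      assume "\<not> ?c \<le> 0.81"
      \<comment> \<open>Dividing the quadratic of \<open>cos_pi_5\<close> by
        \<open>?c - 0.81\<close> leaves remainder 0.0044, and dividing by \<open>?c - 0.809\<close>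
        leaves -0.000076; these signs give both contradictions.\<close>
      then have "0 < (?c - 0.81) * (4 * ?c + 1.24)" using c0 by (intro mult_pos_pos) auto
      then show False using cos_pi_5 by (simp add: power2_eq_square algebra_simps)
    qed
    have c2: "?c \<ge> 0.809"
    proof (rule ccontr)
      assume "\<not> ?c \<ge> 0.809"
      then have "(?c - 0.809) * (4 * ?c + 1.236) < 0" using c0 by (intro mult_neg_pos) auto
      then show False using cos_pi_5 by (simp add: power2_eq_square algebra_simps)
    qed
    have "1 - Q \<ge> 0.58" using Q(2) c1 True by simp
    moreover have "lambda_min n \<le> 0.382" using c2 True by (simp add: lambda_min_def)
    ultimately have "lambda_min n / (?n * (1 - Q)) \<le> 0.382 / (5 * 0.58)"
      using True by (intro frac_le) auto
    moreover have "sqrt (3 / 4) \<le> 0.8661" by (rule real_le_lsqrt) (auto simp: power2_eq_square)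
    ultimately show ?thesis using True by simp
  next
    case False
    then have n6: "?n \<ge> 6" using n by simp
    have "pi\<^sup>2 \<le> 10"
    proof -
      have "pi\<^sup>2 \<le> 3.15\<^sup>2" using pi_approx by (intro power_mono) auto
      then show ?thesis by (simp add: power2_eq_square)
    qed
    then have "pi\<^sup>2 / ?n\<^sup>2 \<le> 10 / ?n\<^sup>2" by (intro divide_right_mono) auto
    moreover have "lambda_min n \<le> (pi / ?n)\<^sup>2"
      unfolding lambda_min_def by (rule two_one_minus_cos_le)
    ultimately have "lambda_min n \<le> 10 / ?n\<^sup>2" by (simp add: power_divide)
    moreover have "?n * (1 - Q) \<ge> ?n / 2" using Qh n5 by (simp add: field_simps)
    ultimately have "lambda_min n / (?n * (1 - Q)) \<le> (10 / ?n\<^sup>2) / (?n / 2)"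
      using n5 by (intro frac_le) auto
    also have "\<dots> = 20 / (?n * ?n\<^sup>2)" using n5 by (simp add: power2_eq_square)
    also have "\<dots> \<le> 1 / (2 * (?n - 1))"
    proof -
      have "36 \<le> ?n\<^sup>2" using power_mono[OF n6, of 2] by simp
      then have "?n * 36 \<le> ?n * ?n\<^sup>2" using n5 by (intro mult_left_mono) auto
      \<comment> \<open>For \<open>n = 6\<close> this reads 200 <= 216; from 7 on,
        \<open>?n\<^sup>2\<close> is at least 49.\<close>
      then have "40 * (?n - 1) \<le> ?n * ?n\<^sup>2"
      proof (cases "?n \<ge> 7")
        case True
        then have "49 \<le> ?n\<^sup>2" using power_mono[OF True, of 2] by simp
        then have "?n * 49 \<le> ?n * ?n\<^sup>2" using n5 by (intro mult_left_mono) auto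
        then show ?thesis using n5 unfolding right_diff_distrib by linarith
      next
        case False
        then have "n = 6" using n6 by linarith
        then show ?thesis by simp
      qed
      then show ?thesis using n5 by (simp add: divide_simps)
    qed
    also have "\<dots> \<le> 1 - sqrt ((?n - 2) / (?n - 1))"
    proof -
      \<comment> \<open>With \<open>m = n - 1\<close> the two sides differ by
        \<open>1 / (4 * m\<^sup>2)\<close>.\<close>
      have "(?n - 2) / (?n - 1) \<le> (1 - 1 / (2 * (?n - 1)))\<^sup>2"
      proof -
        define m where "m = ?n - 1"
        have "m > 0" using n5 by (simp add: m_def)
        then have "(m - 1) / m \<le> (1 - 1 / (2 * m))\<^sup>2"
          by (simp add: power2_eq_square field_simps)
        then show ?thesis by (simp add: m_def)
      qed
      then have "sqrt ((?n - 2) / (?n - 1)) \<le> 1 - 1 / (2 * (?n - 1))"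
        using n5 by (intro real_le_lsqrt) (auto simp: field_simps)
      then show ?thesis by simp
    qed
    finally show ?thesis .
  qed
qed

text \<open>Up to the common denominator, the claimed bound and the Paley-Zygmund bound are squares;
  \<open>lambda_min_gap\<close> compares their bases.\<close>

lemma prob_alg_conn_ge_lambda_min:
  fixes n N :: nat and p :: real
  assumes n: "n \<ge> 5" and p: "0 < p" "p < 1"
  defines "Q \<equiv> (1 - p) ^ N"
  assumes Q: "Q * (3 * real n - 4) \<le> real n - 2 + 2 * cos (pi / real n)"
  shows "measure_pmf.prob (union_gnp n p N) {E. alg_conn n E \<ge> lambda_min n}
    \<ge> (1 - lambda_min n / (real n * (1 - Q)))\<^sup>2
      * ((real n * (1 - Q) - sqrt (2 * real n * (real n - 2) * (1 - Q) * Q))\<^sup>2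
        / (real n * (real n - 2) * (1 - Q)\<^sup>2 + 2 * real n * (1 - Q)))"
proof -
  let ?n = "real n"
  have n5: "?n \<ge> 5" using n by simp
  have Q0: "Q > 0" using p by (simp add: Q_def)
  have Q1: "Q < 1" and gap: "lambda_min n / (?n * (1 - Q)) \<le> 1 - sqrt ((?n - 2) / (?n - 1))"
    using lambda_min_gap[OF n _ Q] Q0 by auto
  define P where "P = 1 - Q"
  define s where "s = sqrt (2 * ?n * (?n - 2) * P * Q)"
  define r where "r = sqrt ((?n - 2) / (?n - 1))"
  define \<theta> where "\<theta> = lambda_min n"
  define S where "S = ?n * (?n - 2) * P\<^sup>2 + 2 * ?n * P"
  have P: "P > 0" using Q1 by (simp add: P_def)
  have S: "S > 0" unfolding S_def using P n5 by (intro add_nonneg_pos mult_nonneg_nonneg) auto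
  have s: "s \<ge> 0" unfolding s_def using P Q0 n5 by simp
  have r: "r \<ge> 0" unfolding r_def using n5 by simp
  have \<theta>: "\<theta> \<ge> 0" by (simp add: \<theta>_def lambda_min_def)
  have g: "\<theta> / (?n * P) \<le> 1 - r" using gap by (simp add: \<theta>_def P_def r_def)
  \<comment> \<open>Keeps the smaller base nonnegative, so that squaring preserves the
    order.\<close>
  have sle: "s \<le> ?n * P"
    unfolding s_def
  proof (rule real_le_lsqrt)
    have "Q * (3 * ?n - 4) \<le> ?n" using Q cos_le_one[of "pi / ?n"] by linarith
    then have "2 * (?n - 2) * Q \<le> ?n * P" by (simp add: P_def algebra_simps)
    then have "(?n * P) * (2 * (?n - 2) * Q) \<le> (?n * P) * (?n * P)"
      using P n5 by (intro mult_left_mono) auto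
    then show "2 * ?n * (?n - 2) * P * Q \<le> (?n * P)\<^sup>2" by (simp add: power2_eq_square mult_ac)
  qed (use P n5 in auto)
  have nonneg: "0 \<le> (1 - \<theta> / (?n * P)) * (?n * P - s)"
    using sle g r by (intro mult_nonneg_nonneg) auto
  have "(1 - \<theta> / (?n * P)) * (?n * P - s) = ?n * P - s - \<theta> + \<theta> / (?n * P) * s"
    using P n5 by (simp add: divide_simps) (simp add: algebra_simps)
  also have "\<dots> \<le> ?n * P - s - \<theta> + (1 - r) * s"
    using g s by (intro add_left_mono mult_right_mono) auto
  also have "\<dots> = ?n * P - s * r - \<theta>" by (simp add: algebra_simps)
  finally have le: "(1 - \<theta> / (?n * P)) * (?n * P - s) \<le> ?n * P - s * r - \<theta>" .
  have "(1 - \<theta> / (?n * P))\<^sup>2 * ((?n * P - s)\<^sup>2 / S) = ((1 - \<theta> / (?n * P)) * (?n * P - s))\<^sup>2 / S"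
    by (simp add: power_mult_distrib)
  also have "\<dots> \<le> (?n * P - s * r - \<theta>)\<^sup>2 / S"
    using le nonneg S by (intro divide_right_mono power_mono) auto
  also have "\<dots> \<le> measure_pmf.prob (union_gnp n p N) {E. alg_conn n E \<ge> \<theta>}"
    using prob_alg_conn_ge_Paley_Zygmund[of n p N \<theta>] n p Q0 Q1 \<theta> le nonneg
    unfolding S_def s_def r_def P_def Q_def by simp
  finally show ?thesis unfolding S_def s_def P_def \<theta>_def .
qed

text \<open>
  In the next two lemmas \<open>P Q \<le> 1 / 4\<close> makes \<open>sqrt (P Q) \<ge> 2 P Q\<close>, which reduces the claim to a
  polynomial inequality in \<open>Q\<close>.
\<close>
lemma quotient_bound_3:
  fixes Q :: real
  assumes Q: "0 < Q" "Q \<le> 2 / 5"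
  shows "(3 * (1 - Q) - sqrt (6 * (1 - Q) * Q))\<^sup>2 / (3 * (1 - Q)\<^sup>2 + 6 * (1 - Q)) \<le> 1 - 3 * Q\<^sup>2"
proof -
  define P where "P = 1 - Q"
  have P: "P \<ge> 3 / 5" "P < 1" using Q by (auto simp: P_def)
  define s where "s = sqrt (6 * P * Q)"
  have s2: "s\<^sup>2 = 6 * P * Q" unfolding s_def using P Q by simp
  have s: "3 * P * Q \<le> s" unfolding s_def
  proof (rule real_le_rsqrt)
    have "P * Q \<le> 1 / 4" 
      using zero_le_power2[of "Q - 1/2"] by (simp add: P_def power2_eq_square algebra_simps)
    then have "9 * (P * Q) * (P * Q) \<le> 6 * (P * Q)" using P Q by (intro mult_right_mono) auto
    then show "(3 * P * Q)\<^sup>2 \<le> 6 * P * Q" by (simp add: power2_eq_square mult_ac)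
  qed
  have "(3 * P - s)\<^sup>2 = 9 * P\<^sup>2 - 6 * P * s + 6 * P * Q"
    using s2 by (simp add: power2_eq_square algebra_simps)
  also have "\<dots> \<le> 9 * P\<^sup>2 - 6 * P * (3 * P * Q) + 6 * P * Q"
    using s P by (intro add_right_mono diff_left_mono mult_left_mono) auto
  also have "\<dots> \<le> (1 - 3 * Q\<^sup>2) * (3 * P\<^sup>2 + 6 * P)"
  proof -
    have "(1 - 3 * Q\<^sup>2) * (3 * P\<^sup>2 + 6 * P) - (9 * P\<^sup>2 - 6 * P * (3 * P * Q) + 6 * P * Q)
      = 3 * P * Q * (6 - 15 * Q + 3 * Q\<^sup>2)"
      unfolding P_def by (simp add: power2_eq_square algebra_simps)
    also have "\<dots> \<ge> 0" using P Q by (intro mult_nonneg_nonneg) auto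
    finally show ?thesis by simp
  qed
  finally have "(3 * P - s)\<^sup>2 \<le> (1 - 3 * Q\<^sup>2) * (3 * P\<^sup>2 + 6 * P)" .
  moreover have "3 * P\<^sup>2 + 6 * P > 0" using P by (intro add_nonneg_pos) auto
  ultimately show ?thesis unfolding P_def[symmetric] s_def[symmetric] by (simp add: pos_divide_le_eq)
qed

lemma quotient_bound_4:
  fixes Q :: real
  assumes Q: "0 < Q" "Q \<le> 43 / 100"
  shows "(4 * (1 - Q) - sqrt (16 * (1 - Q) * Q))\<^sup>2 / (8 * (1 - Q)\<^sup>2 + 8 * (1 - Q)) \<le> 1 - 5 * Q\<^sup>2"
proof -
  define P where "P = 1 - Q"
  have P: "P \<ge> 57 / 100" "P < 1" using Q by (auto simp: P_def)
  define s where "s = sqrt (16 * P * Q)"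
  have s2: "s\<^sup>2 = 16 * P * Q" unfolding s_def using P Q by simp
  have s: "8 * P * Q \<le> s" unfolding s_def
  proof (rule real_le_rsqrt)
    have "P * Q \<le> 1 / 4" 
      using zero_le_power2[of "Q - 1/2"] by (simp add: P_def power2_eq_square algebra_simps)
    then have "64 * (P * Q) * (P * Q) \<le> 16 * (P * Q)" using P Q by (intro mult_right_mono) auto
    then show "(8 * P * Q)\<^sup>2 \<le> 16 * P * Q" by (simp add: power2_eq_square mult_ac)
  qed
  have "(4 * P - s)\<^sup>2 = 16 * P\<^sup>2 - 8 * P * s + 16 * P * Q"
    using s2 by (simp add: power2_eq_square algebra_simps)
  also have "\<dots> \<le> 16 * P\<^sup>2 - 8 * P * (8 * P * Q) + 16 * P * Q"
    using s P by (intro add_right_mono diff_left_mono mult_left_mono) auto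
  also have "\<dots> \<le> (1 - 5 * Q\<^sup>2) * (8 * P\<^sup>2 + 8 * P)"
  proof -
    have "(1 - 5 * Q\<^sup>2) * (8 * P\<^sup>2 + 8 * P) - (16 * P\<^sup>2 - 8 * P * (8 * P * Q) + 16 * P * Q)
      = 8 * P * Q * (7 - 18 * Q + 5 * Q\<^sup>2)"
      unfolding P_def by (simp add: power2_eq_square algebra_simps)
    also have "\<dots> \<ge> 0"
    proof -
      \<comment> \<open>The constant 15.85 makes the linear coefficient -18; the constant term is
        then 6.8155, below 7.\<close>
      have "0 \<le> (43 / 100 - Q) * (1585 / 100 - 5 * Q)" using Q by (intro mult_nonneg_nonneg) auto
      then have "7 - 18 * Q + 5 * Q\<^sup>2 \<ge> 0" by (simp add: power2_eq_square algebra_simps)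
      then show ?thesis using P Q by (intro mult_nonneg_nonneg) auto
    qed
    finally show ?thesis by simp
  qed
  finally have "(4 * P - s)\<^sup>2 \<le> (1 - 5 * Q\<^sup>2) * (8 * P\<^sup>2 + 8 * P)" .
  moreover have "8 * P\<^sup>2 + 8 * P > 0" using P by (intro add_nonneg_pos) auto
  ultimately show ?thesis unfolding P_def[symmetric] s_def[symmetric] by (simp add: pos_divide_le_eq)
qed

text \<open>For \<open>n = 3\<close> and \<open>n = 4\<close> the first factor of the claim lies
  between 0 and 1 and is simply dropped.\<close>

lemma mult_factor_le:
  fixes t P a b :: real
  assumes "0 \<le> t" "t \<le> P" "0 < P" "0 \<le> a" "a \<le> b"
  shows "(1 - t / P)\<^sup>2 * a \<le> b"
proof -
  have "0 \<le> t / P" "t / P \<le> 1" using assms by auto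
  then have "(1 - t / P)\<^sup>2 \<le> 1" by (intro power_le_one) auto
  then have "(1 - t / P)\<^sup>2 * a \<le> 1 * a" using assms by (intro mult_right_mono) auto
  then show ?thesis using assms by simp
qed

text \<open>For \<open>n = 2\<close> the argument of the logarithm in \<open>N_min\<close> is 0, and
  for \<open>n = 1\<close> there is no second eigenvalue; hence \<open>n \<ge> 3\<close>.\<close>

theorem theorem3:
  fixes n N :: nat and p :: real
  assumes "n \<ge> 3"
    and "0 < p" and "p < 1"
    and "real N \<ge> N_min n p"
  shows "let ph = 1 - (1 - p) ^ N; qh = 1 - ph in
    measure_pmf.prob (union_gnp n p N) {E. alg_conn n E \<ge> lambda_min n}
      \<ge> (1 - 2 * (1 - cos (pi / real n)) / (real n * ph))^2
         * ((real n * ph - sqrt (2 * real n * (real n - 2) * ph * qh))^2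
            / (real n * (real n - 2) * ph^2 + 2 * real n * ph))"
proof -
  define Q where "Q = (1 - p) ^ N"
  have Q0: "Q > 0" using assms by (simp add: Q_def)
  have Q: "Q * (3 * real n - 4) \<le> real n - 2 + 2 * cos (pi / real n)"
    using N_min_imp_power_le assms by (simp add: Q_def)
  have "(1 - lambda_min n / (real n * (1 - Q)))\<^sup>2
      * ((real n * (1 - Q) - sqrt (2 * real n * (real n - 2) * (1 - Q) * Q))\<^sup>2
        / (real n * (real n - 2) * (1 - Q)\<^sup>2 + 2 * real n * (1 - Q)))
    \<le> measure_pmf.prob (union_gnp n p N) {E. alg_conn n E \<ge> lambda_min n}"
  proof -
    consider "n = 3" | "n = 4" | "n \<ge> 5" using assms(1) by linarith
    then show ?thesis
    proof cases
      case 1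
      have Q3: "Q \<le> 2 / 5" using Q 1 by (simp add: cos_60)
      have l: "lambda_min n = 1" using 1 by (simp add: lambda_min_def cos_60)
      have "1 - 3 * Q\<^sup>2 \<le> measure_pmf.prob (union_gnp n p N) {E. alg_conn n E \<ge> lambda_min n}"
        using prob_alg_conn_ge_3[of p N] assms 1 l by (simp add: Q_def)
      moreover have "(3 * (1 - Q) - sqrt (6 * (1 - Q) * Q))\<^sup>2 / (3 * (1 - Q)\<^sup>2 + 6 * (1 - Q)) \<ge> 0"
        using Q3 by (intro divide_nonneg_nonneg) auto
      ultimately have "(1 - 1 / (3 * (1 - Q)))\<^sup>2 * ((3 * (1 - Q) - sqrt (6 * (1 - Q) * Q))\<^sup>2 / (3 * (1 - Q)\<^sup>2 + 6 * (1 - Q)))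
        \<le> measure_pmf.prob (union_gnp n p N) {E. alg_conn n E \<ge> lambda_min n}"
        using quotient_bound_3[OF Q0 Q3] Q3 by (intro mult_factor_le) auto
      then show ?thesis using 1 l by simp
    next
      case 2
      have s: "sqrt 2 \<le> 1.42" by (rule real_le_lsqrt) (auto simp: power2_eq_square)
      have Q4: "Q \<le> 43 / 100" using Q 2 s by (simp add: cos_45)
      have l: "lambda_min n = 2 - sqrt 2" using 2 by (simp add: lambda_min_def cos_45)
      have "1 - 5 * Q\<^sup>2 \<le> measure_pmf.prob (union_gnp n p N) {E. alg_conn n E \<ge> lambda_min n}"
        using prob_alg_conn_ge_4[of p N] assms 2 l by (simp add: Q_def)
      moreover have "(4 * (1 - Q) - sqrt (16 * (1 - Q) * Q))\<^sup>2 / (8 * (1 - Q)\<^sup>2 + 8 * (1 - Q)) \<ge> 0"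
        using Q4 by (intro divide_nonneg_nonneg) auto
      moreover have "0 \<le> 2 - sqrt 2" using s by simp
      moreover have "2 - sqrt 2 \<le> 4 * (1 - Q)"
        using Q4 real_sqrt_ge_zero[of 2] unfolding right_diff_distrib by linarith
      ultimately have "(1 - (2 - sqrt 2) / (4 * (1 - Q)))\<^sup>2 * ((4 * (1 - Q) - sqrt (16 * (1 - Q) * Q))\<^sup>2 / (8 * (1 - Q)\<^sup>2 + 8 * (1 - Q)))
        \<le> measure_pmf.prob (union_gnp n p N) {E. alg_conn n E \<ge> lambda_min n}"
        using quotient_bound_4[OF Q0 Q4] Q4 by (intro mult_factor_le) auto
      then show ?thesis using 2 l by simp
    next
      case 3
      then show ?thesis using prob_alg_conn_ge_lambda_min[of n p N] assms Q by (simp add: Q_def)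
    qed
  qed
  then show ?thesis by (simp add: Let_def Q_def lambda_min_def)
qed

end
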